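(* Let $\alpha$ be a weakly Chaitin random real and let $V$ be an optimal computer. For every total recursive function $f\colon\mathbb{N}^+\to\mathbb{N}$, if there exists an oracle deterministic Turing machine $M$ such that, for infinitely many $n\in\mathbb{N}^+$, $M^{\mathrm{Dom}\,V\restriction n}(n)=\alpha\restriction(n-f(n))$, then $f$ is not bounded from above.
   Context: $\{0,1\}^*$ is the set of finite binary strings. A computer is a partial recursive function $C\colon\{0,1\}^*\to\{0,1\}^*$ whose domain $\mathrm{Dom}\,C$ is prefix-free. A computer $U$ is optimal if for every computer $C$ there is $d\in\mathbb{N}$ such that for every $p\in\mathrm{Dom}\,C$ there is $q$ with $U(q)=C(p)$ and $|q|\le|p|+d$. Fix an optimal computer $U$ and let $H(s)=\min\{|p|:U(p)=s\}$. A real $\alpha$ is weakly Chaitin random if there is $c\in\mathbb{N}$ with $n-c\le H(\alpha\restriction n)$ for all $n\in\mathbb{N}^+$. For $S\subseteq\{0,1\}^*$ and $n\in\mathbb{Z}$, $S\restriction n=\{s\in S:|s|\le n\}$. For a real $\alpha$ and $n\in\mathbb{N}^+$, $\alpha\restriction n$ is the string of the first $n$ bits of the base-two expansion of $\alpha-\lfloor\alpha\rfloor$ (with infinitely many zeros when there is a choice); for integers $n\le0$ it is the empty string. $M^A(n)$ is the output of oracle machine $M$ on input $n$ with oracle set $A$. *)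

theory Defs
  imports Complex_Main "HOL-Library.Sublist"
begin

text \<open>
  Binary strings are lists of booleans, with \<^term>\<open>False\<close> for the bit 0 and \<^term>\<open>True\<close> for the bit 1.
\<close>

section \<open>Partial recursive functions\<close>

text \<open>
  Kleene's schemes. Terms carry no arity: the number of arguments is the length of the list on
  which they are evaluated, and a term has no value on a list of unsuitable length.
\<close>

datatype recf =
    Zero
  | Succ
  | Proj nat
  | Comp recf "recf list"
  | PrimRec recf recf
  | Mu recf

inductive eval_recf :: "recf \<Rightarrow> nat list \<Rightarrow> nat \<Rightarrow> bool" where
  "eval_recf Zero xs 0"
| "eval_recf Succ [x] (Suc x)"
| "i < length xs \<Longrightarrow> eval_recf (Proj i) xs (xs ! i)"
| "list_all2 (\<lambda>g y. eval_recf g xs y) gs ys \<Longrightarrow> eval_recf f ys z \<Longrightarrow> eval_recf (Comp f gs) xs z"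
| "eval_recf f xs y \<Longrightarrow> eval_recf (PrimRec f g) (0 # xs) y"
| "eval_recf (PrimRec f g) (n # xs) y \<Longrightarrow> eval_recf g (n # y # xs) z
    \<Longrightarrow> eval_recf (PrimRec f g) (Suc n # xs) z"
| "eval_recf f (n # xs) 0 \<Longrightarrow> (\<And>k. k < n \<Longrightarrow> \<exists>y>0. eval_recf f (k # xs) y)
    \<Longrightarrow> eval_recf (Mu f) xs n"

inductive_cases eval_recf_ZeroE: "eval_recf Zero xs y"
inductive_cases eval_recf_SuccE: "eval_recf Succ xs y"
inductive_cases eval_recf_ProjE: "eval_recf (Proj i) xs y"
inductive_cases eval_recf_CompE: "eval_recf (Comp f gs) xs y"
inductive_cases eval_recf_PrimRec0E: "eval_recf (PrimRec f g) (0 # xs) y"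
inductive_cases eval_recf_PrimRecSucE: "eval_recf (PrimRec f g) (Suc n # xs) y"
inductive_cases eval_recf_MuE: "eval_recf (Mu f) xs y"

lemma eval_recf_deterministic: "eval_recf f xs y \<Longrightarrow> eval_recf f xs z \<Longrightarrow> y = z"
proof (induction arbitrary: z rule: eval_recf.induct)
  case (4 xs gs ys f w)
  from "4.prems" obtain ys' where ys': "list_all2 (\<lambda>g y. eval_recf g xs y) gs ys'" "eval_recf f ys' z"
    by (auto elim: eval_recf_CompE)
  have "ys = ys'"
    using "4.IH"(1) ys'(1) by (auto simp: list_all2_conv_all_nth intro!: nth_equalityI)
  then show ?case using "4.IH"(2) ys'(2) by blast
next
  case (7 f n xs)
  from "7.prems" have z: "eval_recf f (z # xs) 0" "\<And>k. k < z \<Longrightarrow> \<exists>y>0. eval_recf f (k # xs) y"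
    by (auto elim: eval_recf_MuE)
  show ?case
  proof (rule linorder_cases[of n z])
    assume "n < z"
    then obtain y where "y > 0" "eval_recf f (n # xs) y" using z(2) by blast
    then show ?thesis using "7.IH"(1) by fastforce
  next
    assume "z < n"
    then show ?thesis using "7.IH"(2) z(1) by fastforce
  qed simp
qed (blast elim: eval_recf_ZeroE eval_recf_SuccE eval_recf_ProjE eval_recf_PrimRec0E
      eval_recf_PrimRecSucE)+

text \<open>
  The position of a string in the length-lexicographic enumeration of all strings (empty string, 0,
  1, 00, 01, 10, 11, 000, ...), counted from 0.
\<close>

definition string_code :: "bool list \<Rightarrow> nat" where
  "string_code s = foldl (\<lambda>m b. 2 * m + (if b then 2 else 1)) 0 s"

lemma string_code_simps [simp]:
  "string_code [] = 0"
  "string_code (s @ [b]) = 2 * string_code s + (if b then 2 else 1)"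
  by (simp_all add: string_code_def)

lemma bij_string_code: "bij string_code"
proof (rule bijI)
  have "string_code s = string_code t \<Longrightarrow> s = t" for s t
  proof (induction s arbitrary: t rule: rev_induct)
    case Nil
    then show ?case by (cases t rule: rev_cases) (auto split: if_splits)
  next
    case (snoc b s)
    obtain t' c where t: "t = t' @ [c]"
      using snoc.prems by (cases t rule: rev_cases) (auto split: if_splits)
    from snoc.prems have "2 * string_code s + (if b then 2 else 1)
        = 2 * string_code t' + (if c then 2 else 1)"
      by (simp add: t)
    then have "b = c \<and> string_code s = string_code t'"
      by (cases b; cases c) (simp_all, presburger+)
    then show ?case using snoc.IH by (simp add: t)
  qed
  then show "inj string_code" by (auto intro: injI)
next
  have "\<exists>s. string_code s = n" for n
  proof (induction n rule: less_induct)
    case (less n)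
    show ?case
    proof (cases "n = 0")
      case True
      then show ?thesis by (intro exI[of _ "[]"]) simp
    next
      case False
      obtain s where s: "string_code s = (n - 1) div 2" using less[of "(n - 1) div 2"] False by fastforce
      have "string_code (s @ [even n]) = n"
        using False by (cases "even n") (auto simp: s elim!: evenE oddE)
      then show ?thesis by blast
    qed
  qed
  then show "surj string_code" by (metis surjI)
qed

definition partial_recursive :: "(bool list \<rightharpoonup> bool list) \<Rightarrow> bool" where
  "partial_recursive C \<longleftrightarrow>
    (\<exists>f. \<forall>p s. C p = Some s \<longleftrightarrow> eval_recf f [string_code p] (string_code s))"

text \<open>
  Total recursive functions from the positive integers to the natural numbers; the value at 0
  is irrelevant.
\<close>

definition total_recursive_pos :: "(nat \<Rightarrow> nat) \<Rightarrow> bool" where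
  "total_recursive_pos f \<longleftrightarrow> (\<exists>g. \<forall>n\<ge>1. eval_recf g [n] (f n))"

section \<open>Computers and program-size complexity\<close>

definition prefix_free :: "bool list set \<Rightarrow> bool" where
  "prefix_free S \<longleftrightarrow> (\<forall>s\<in>S. \<forall>t\<in>S. prefix s t \<longrightarrow> s = t)"

definition computer :: "(bool list \<rightharpoonup> bool list) \<Rightarrow> bool" where
  "computer C \<longleftrightarrow> partial_recursive C \<and> prefix_free (dom C)"

definition optimal :: "(bool list \<rightharpoonup> bool list) \<Rightarrow> bool" where
  "optimal U \<longleftrightarrow> computer U \<and>
    (\<forall>C. computer C \<longrightarrow>
      (\<exists>d::nat. \<forall>p\<in>dom C. \<exists>q. U q = C p \<and> length q \<le> length p + d))"

definition H :: "(bool list \<rightharpoonup> bool list) \<Rightarrow> bool list \<Rightarrow> nat" where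
  "H U s = (LEAST k. \<exists>p. U p = Some s \<and> k = length p)"

definition restrict_strings :: "bool list set \<Rightarrow> int \<Rightarrow> bool list set" where
  "restrict_strings S n = {s \<in> S. int (length s) \<le> n}"

section \<open>Base-two expansions\<close>

text \<open>The digit \<^term>\<open>b i\<close> has weight $2^{-(i+1)}$, so digits are counted from 0.\<close>

definition is_binary_expansion :: "real \<Rightarrow> (nat \<Rightarrow> bool) \<Rightarrow> bool" where
  "is_binary_expansion x b \<longleftrightarrow>
    (\<lambda>i. of_bool (b i) / 2 ^ Suc i) sums x \<and> infinite {i. \<not> b i}"

definition fractional_bits :: "real \<Rightarrow> nat \<Rightarrow> bool" where
  "fractional_bits \<alpha> = (THE b. is_binary_expansion (\<alpha> - of_int \<lfloor>\<alpha>\<rfloor>) b)"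

definition restrict_real :: "real \<Rightarrow> int \<Rightarrow> bool list" where
  "restrict_real \<alpha> k = map (fractional_bits \<alpha>) [0..<nat k]"

lemma is_binary_expansion_floor:
  assumes "is_binary_expansion x b"
  shows "b i \<longleftrightarrow> odd \<lfloor>x * 2 ^ Suc i\<rfloor>"
proof -
  let ?a = "\<lambda>i. of_bool (b i) / 2 ^ Suc i :: real"
  have sums: "?a sums x" and inf: "infinite {i. \<not> b i}"
    using assms by (auto simp: is_binary_expansion_def)
  have geo: "(\<lambda>i. 1 / 2 ^ Suc i :: real) sums 1"
    by (rule power_half_series[unfolded power_divide power_one])
  have tail: "(0::real) \<le> (\<Sum>j. of_bool (b (j + n)) / 2 ^ Suc j) \<and>
      (\<Sum>j. of_bool (b (j + n)) / 2 ^ Suc j) < (1::real)" for n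
  proof -
    let ?c = "\<lambda>j. of_bool (b (j + n)) / 2 ^ Suc j :: real"
    have le: "?c j \<le> 1 / 2 ^ Suc j" for j by simp
    have summ: "summable ?c"
      by (rule summable_comparison_test'[where N = 0, OF sums_summable[OF geo]]) simp
    obtain m where m: "m \<ge> n" "\<not> b m"
      using inf by (auto simp: finite_nat_set_iff_bounded not_less)
    have "0 < (\<Sum>j. 1 / 2 ^ Suc j - ?c j)"
    proof (rule suminf_pos2)
      show "summable (\<lambda>j. 1 / 2 ^ Suc j - ?c j)"
        by (intro summable_diff summ sums_summable[OF geo])
      show "0 < 1 / 2 ^ Suc (m - n) - ?c (m - n)" using m by simp
    qed (use le in auto)
    also have "\<dots> = 1 - suminf ?c"
      using suminf_diff[OF sums_summable[OF geo] summ] sums_unique[OF geo] by simp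
    finally show ?thesis using suminf_nonneg[OF summ] by simp
  qed
  have floor: "\<lfloor>x * 2 ^ n\<rfloor> = (\<Sum>j<n. of_bool (b j) * 2 ^ (n - Suc j))" for n
  proof -
    have split: "x = (\<Sum>j. ?a (j + n)) + (\<Sum>j<n. ?a j)"
      using suminf_split_initial_segment[OF sums_summable[OF sums], of n] sums_unique[OF sums]
      by simp
    have upper: "(\<Sum>j. ?a (j + n)) * 2 ^ n = (\<Sum>j. of_bool (b (j + n)) / 2 ^ Suc j)"
    proof -
      have "summable (\<lambda>j. ?a (j + n))"
        by (rule summable_ignore_initial_segment[OF sums_summable[OF sums]])
      then have "(\<Sum>j. ?a (j + n)) * 2 ^ n = (\<Sum>j. ?a (j + n) * 2 ^ n)"
        by (rule suminf_mult2)
      also have "(\<lambda>j. ?a (j + n) * 2 ^ n) = (\<lambda>j. of_bool (b (j + n)) / 2 ^ Suc j)"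
        by (rule ext) (simp add: power_add field_simps)
      finally show ?thesis .
    qed
    have lower: "(\<Sum>j<n. ?a j) * 2 ^ n = of_int (\<Sum>j<n. of_bool (b j) * 2 ^ (n - Suc j))"
    proof -
      have "?a j * 2 ^ n = of_int (of_bool (b j) * 2 ^ (n - Suc j))" if "j < n" for j
      proof -
        have "(2::real) ^ n = 2 ^ Suc j * 2 ^ (n - Suc j)" using that
          by (metis Suc_leI le_add_diff_inverse power_add)
        then show ?thesis by simp
      qed
      then show ?thesis by (simp add: sum_distrib_right)
    qed
    have "x * 2 ^ n = (\<Sum>j. of_bool (b (j + n)) / 2 ^ Suc j)
        + of_int (\<Sum>j<n. of_bool (b j) * 2 ^ (n - Suc j))"
      unfolding upper[symmetric] lower[symmetric] distrib_right[symmetric] split[symmetric] ..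
    then show ?thesis using tail[of n] by (intro floor_unique) linarith+
  qed
  have "\<lfloor>x * 2 ^ Suc i\<rfloor> = of_bool (b i) + 2 * \<lfloor>x * 2 ^ i\<rfloor>"
  proof -
    have "(\<Sum>j<i. of_bool (b j) * 2 ^ (Suc i - Suc j)) =
        2 * (\<Sum>j<i. of_bool (b j) * 2 ^ (i - Suc j) :: int)"
      unfolding sum_distrib_left
    proof (rule sum.cong)
      fix j assume "j \<in> {..<i}"
      then have "Suc i - Suc j = Suc (i - Suc j)" by auto
      then show "of_bool (b j) * 2 ^ (Suc i - Suc j) = 2 * (of_bool (b j) * 2 ^ (i - Suc j) :: int)"
        by (simp only: power_Suc mult.left_commute)
    qed simp
    then show ?thesis unfolding floor by simp
  qed
  then show ?thesis by simp
qed

lemma is_binary_expansion_exists: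
  assumes "0 \<le> x" "x < 1"
  shows "is_binary_expansion x (\<lambda>i. odd \<lfloor>x * 2 ^ Suc i\<rfloor>)"
proof -
  have step: "\<lfloor>x * 2 ^ Suc i\<rfloor> = 2 * \<lfloor>x * 2 ^ i\<rfloor> + of_bool (odd \<lfloor>x * 2 ^ Suc i\<rfloor>)" for i
  proof -
    have "\<lfloor>x * 2 ^ Suc i\<rfloor> div 2 = \<lfloor>x * 2 ^ i\<rfloor>"
      using floor_divide_real_eq_div[of 2 "x * 2 ^ Suc i"] by simp
    then show ?thesis by (metis mod_2_eq_odd mult_div_mod_eq)
  qed
  let ?a = "\<lambda>i. of_bool (odd \<lfloor>x * 2 ^ Suc i\<rfloor>) / 2 ^ Suc i :: real"
  have partial: "(\<Sum>i<n. ?a i) = of_int \<lfloor>x * 2 ^ n\<rfloor> / 2 ^ n" for n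
  proof (induction n)
    case 0
    have "\<lfloor>x\<rfloor> = 0" using assms by (simp add: floor_eq_iff)
    then show ?case by simp
  next
    case (Suc n)
    have "real_of_int \<lfloor>x * 2 ^ Suc n\<rfloor> =
        2 * of_int \<lfloor>x * 2 ^ n\<rfloor> + of_bool (odd \<lfloor>x * 2 ^ Suc n\<rfloor>)"
      by (subst step) simp
    then show ?case
      unfolding sum.lessThan_Suc Suc by (simp add: field_simps)
  qed
  have "(\<lambda>n. of_int \<lfloor>x * 2 ^ n\<rfloor> / 2 ^ n) \<longlonglongrightarrow> x"
  proof (rule tendsto_sandwich)
    show "\<forall>\<^sub>F n in sequentially. x - (1 / 2) ^ n \<le> of_int \<lfloor>x * 2 ^ n\<rfloor> / 2 ^ n"
    proof (intro always_eventually allI)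
      fix n
      have "x - (1 / 2) ^ n = (x * 2 ^ n - 1) / 2 ^ n" by (simp add: field_simps)
      also have "\<dots> \<le> of_int \<lfloor>x * 2 ^ n\<rfloor> / 2 ^ n"
        by (rule divide_right_mono) (linarith, simp)
      finally show "x - (1 / 2) ^ n \<le> of_int \<lfloor>x * 2 ^ n\<rfloor> / 2 ^ n" .
    qed
    show "\<forall>\<^sub>F n in sequentially. of_int \<lfloor>x * 2 ^ n\<rfloor> / 2 ^ n \<le> x"
      by (intro always_eventually allI) (simp add: divide_le_eq)
    have "(\<lambda>n. x - (1 / 2) ^ n) \<longlonglongrightarrow> x - 0"
      by (intro tendsto_diff tendsto_const LIMSEQ_realpow_zero) auto
    then show "(\<lambda>n. x - (1 / 2) ^ n) \<longlonglongrightarrow> x" by simp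
  qed simp
  then have "?a sums x" unfolding sums_def partial .
  moreover have "infinite {i. \<not> odd \<lfloor>x * 2 ^ Suc i\<rfloor>}"
  proof
    assume "finite {i. \<not> odd \<lfloor>x * 2 ^ Suc i\<rfloor>}"
    then obtain N where N: "\<And>i. i \<ge> N \<Longrightarrow> odd \<lfloor>x * 2 ^ Suc i\<rfloor>"
      by (auto simp: finite_nat_set_iff_bounded) (meson leD)
    define r where "r n = 1 - (x * 2 ^ n - of_int \<lfloor>x * 2 ^ n\<rfloor>)" for n
    have r: "r (N + k) = r N * 2 ^ k" for k
    proof (induction k)
      case (Suc k)
      have "real_of_int \<lfloor>x * 2 ^ Suc (N + k)\<rfloor> = 2 * of_int \<lfloor>x * 2 ^ (N + k)\<rfloor> + 1"
        by (subst step) (use N[of "N + k"] in simp)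
      then have "r (Suc (N + k)) = 2 * r (N + k)"
        by (simp add: r_def)
      then show ?case using Suc by simp
    qed simp
    have bounds: "0 < r n" "r n \<le> 1" for n unfolding r_def by linarith+
    obtain k where "1 / r N < 2 ^ k" using real_arch_pow[of 2 "1 / r N"] by auto
    then have "1 < r (N + k)" using bounds(1)[of N] by (simp add: r field_simps)
    then show False using bounds(2)[of "N + k"] by simp
  qed
  ultimately show ?thesis by (simp add: is_binary_expansion_def)
qed

lemma fractional_bits_floor:
  "fractional_bits \<alpha> i \<longleftrightarrow> odd \<lfloor>(\<alpha> - of_int \<lfloor>\<alpha>\<rfloor>) * 2 ^ Suc i\<rfloor>"
proof -
  have ex: "is_binary_expansion (\<alpha> - of_int \<lfloor>\<alpha>\<rfloor>) (\<lambda>i. odd \<lfloor>(\<alpha> - of_int \<lfloor>\<alpha>\<rfloor>) * 2 ^ Suc i\<rfloor>)"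
    by (intro is_binary_expansion_exists) linarith+
  then have "(THE b. is_binary_expansion (\<alpha> - of_int \<lfloor>\<alpha>\<rfloor>) b) =
      (\<lambda>i. odd \<lfloor>(\<alpha> - of_int \<lfloor>\<alpha>\<rfloor>) * 2 ^ Suc i\<rfloor>)"
  proof (rule the_equality[where P = "is_binary_expansion (\<alpha> - of_int \<lfloor>\<alpha>\<rfloor>)"])
    fix b assume "is_binary_expansion (\<alpha> - of_int \<lfloor>\<alpha>\<rfloor>) b"
    then show "b = (\<lambda>i. odd \<lfloor>(\<alpha> - of_int \<lfloor>\<alpha>\<rfloor>) * 2 ^ Suc i\<rfloor>)"
      by (intro ext) (rule is_binary_expansion_floor)
  qed
  then show ?thesis by (simp only: fractional_bits_def)
qed

definition weakly_chaitin_random :: "(bool list \<rightharpoonup> bool list) \<Rightarrow> real \<Rightarrow> bool" where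
  "weakly_chaitin_random U \<alpha> \<longleftrightarrow>
    (\<exists>c::nat. \<forall>n\<ge>1::nat. int n - int c \<le> int (H U (restrict_real \<alpha> (int n))))"

section \<open>Oracle deterministic Turing machines\<close>

datatype symbol = Blank | Bit bool | Aux nat

datatype direction = Move_Left | Stay | Move_Right

text \<open>
  A two-way infinite tape. In \<^term>\<open>Tape ls rs\<close> the list \<^term>\<open>rs\<close> holds the scanned cell and the
  cells to its right, and \<^term>\<open>ls\<close> the cells to the left of the scanned cell, nearest first. All
  cells beyond the two lists are blank.
\<close>

datatype tape = Tape "symbol list" "symbol list"

fun cell :: "symbol list \<Rightarrow> symbol" where
  "cell [] = Blank"
| "cell (x # xs) = x"

fun tape_read :: "tape \<Rightarrow> symbol" where
  "tape_read (Tape ls rs) = cell rs"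

fun tape_write :: "symbol \<Rightarrow> tape \<Rightarrow> tape" where
  "tape_write x (Tape ls rs) = Tape ls (x # tl rs)"

fun tape_move :: "direction \<Rightarrow> tape \<Rightarrow> tape" where
  "tape_move Move_Left (Tape ls rs) = Tape (tl ls) (cell ls # rs)"
| "tape_move Stay t = t"
| "tape_move Move_Right (Tape ls rs) = Tape (cell rs # ls) (tl rs)"

fun bit_prefix :: "symbol list \<Rightarrow> bool list" where
  "bit_prefix (Bit b # xs) = b # bit_prefix xs"
| "bit_prefix _ = []"

text \<open>
  The string on a tape starts at the scanned cell and extends to the right up to the first cell
  that does not hold a bit.
\<close>

fun tape_string :: "tape \<Rightarrow> bool list" where
  "tape_string (Tape ls rs) = bit_prefix rs"

text \<open>
  A machine has a work tape, which also carries input and output, and a query tape. The transition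
  function maps the state and the two scanned symbols to the next state and, for the work tape and
  the query tape, the symbol to write and the direction to move. In the query state the machine
  passes to the yes state or the no state, according to whether the string on the query tape
  belongs to the oracle set, and the tapes are unchanged.
\<close>

record oracle_machine =
  states :: "nat set"
  alphabet :: "symbol set"
  start_state :: nat
  halt_state :: nat
  query_state :: nat
  yes_state :: nat
  no_state :: nat
  transition ::
    "nat \<Rightarrow> symbol \<Rightarrow> symbol \<Rightarrow> nat \<times> (symbol \<times> direction) \<times> (symbol \<times> direction)"

definition oracle_turing_machine :: "oracle_machine \<Rightarrow> bool" where
  "oracle_turing_machine M \<longleftrightarrow>
    finite (states M) \<and> finite (alphabet M) \<and>
    {Blank, Bit False, Bit True} \<subseteq> alphabet M \<and>
    {start_state M, halt_state M, query_state M, yes_state M, no_state M} \<subseteq> states M \<and>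
    (\<forall>q\<in>states M. \<forall>a\<in>alphabet M. \<forall>b\<in>alphabet M.
      transition M q a b \<in> states M \<times> (alphabet M \<times> UNIV) \<times> (alphabet M \<times> UNIV))"

type_synonym config = "nat \<times> tape \<times> tape"

definition machine_step :: "oracle_machine \<Rightarrow> bool list set \<Rightarrow> config \<Rightarrow> config" where
  "machine_step M A = (\<lambda>(q, w, v).
    if q = halt_state M then (q, w, v)
    else if q = query_state M then
      (if tape_string v \<in> A then yes_state M else no_state M, w, v)
    else case transition M q (tape_read w) (tape_read v) of
      (q', (a, d), (b, e)) \<Rightarrow>
        (q', tape_move d (tape_write a w), tape_move e (tape_write b v)))"

text \<open>Binary notation without leading zeros, most significant digit first.\<close>

fun binary_numeral :: "nat \<Rightarrow> bool list" where
  "binary_numeral n = (if n = 0 then [] else binary_numeral (n div 2) @ [odd n])"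

declare binary_numeral.simps [simp del]

definition initial_config :: "oracle_machine \<Rightarrow> nat \<Rightarrow> config" where
  "initial_config M n = (start_state M, Tape [] (map Bit (binary_numeral n)), Tape [] [])"

definition machine_config :: "oracle_machine \<Rightarrow> bool list set \<Rightarrow> nat \<Rightarrow> nat \<Rightarrow> config" where
  "machine_config M A n t = (machine_step M A ^^ t) (initial_config M n)"

definition machine_output :: "oracle_machine \<Rightarrow> bool list set \<Rightarrow> nat \<Rightarrow> bool list option" where
  "machine_output M A n =
    (if \<exists>t. fst (machine_config M A n t) = halt_state M
     then Some (tape_string (fst (snd (machine_config M A n
       (LEAST t. fst (machine_config M A n t) = halt_state M)))))
     else None)"

end

theory Submission
  imports Defs "HOL-Library.Nat_Bijection"
begin

text \<open>
  Suppose that \<open>f\<close> is bounded; by the pigeonhole principle it takes a value \<open>b\<close> at infinitely many of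
  the given \<open>n\<close>. Run \<open>M\<close> on \<open>n\<close> with the successive finite approximations of the programs of \<open>V\<close> of
  length at most \<open>n\<close> as oracle. If there are \<open>N n\<close> such programs, the oracle takes at most \<open>N n + 1\<close>
  values, which gives at most \<open>N n + 1\<close> outputs of length \<open>n - b\<close>. By Kraft's inequality the sum of the
  \<open>N n / 2 ^ n\<close> is at most 2, hence all these outputs together form a Solovay test of total weight at
  most \<open>2 ^ (b + 2)\<close>, and infinitely many of them are prefixes of \<open>\<alpha>\<close>. The strings that extend \<open>4 ^ k\<close>
  outputs have measure \<open>O(1 / 4 ^ k)\<close>, so the Kraft--Chaitin theorem provides one computer that
  saves \<open>k - O(1)\<close> bits on each of them, for all \<open>k\<close> at once. This contradicts the randomness of \<open>\<alpha>\<close>.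
\<close>

section \<open>Total recursive functions\<close>

text \<open>One correct output need not compress \<open>\<alpha>\<close> by a prescribed amount;
  what grows is the number of correct \<open>n\<close>. The test therefore counts, for a string, the
  \<open>n\<close> at which some output is a prefix of it. The obstacle is that the true oracle is
  not computable uniformly in \<open>n\<close>: no stage announces that its approximation is
  complete. They remain few because the approximations form an increasing chain, in which a set is
  determined by its cardinality. The threshold \<open>4 ^ k\<close> for a saving of \<open>k\<close>
  bits makes the price \<open>2 ^ k / 4 ^ k\<close> of level \<open>k\<close> summable; with the
  threshold \<open>2 ^ k\<close> every level would cost the same. The computers must be given by
  Kleene terms. Functions on strings, lists and tapes are therefore tracked on codes by total
  recursive functions, and unbounded search is added only when a computer is built.\<close>

definition rec_total :: "nat \<Rightarrow> (nat list \<Rightarrow> nat) \<Rightarrow> bool" where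
  "rec_total n F \<longleftrightarrow> (\<exists>r. \<forall>xs. length xs = n \<longrightarrow> eval_recf r xs (F xs))"

named_theorems rec_total_intros

lemma rec_total_cong:
  assumes "rec_total n F" "\<And>xs. length xs = n \<Longrightarrow> F xs = G xs"
  shows "rec_total n G"
  using assms unfolding rec_total_def by metis

lemma rec_total_zero: "rec_total n (\<lambda>_. 0)"
  unfolding rec_total_def by (auto intro: eval_recf.intros)

lemma rec_total_proj: "i < n \<Longrightarrow> rec_total n (\<lambda>xs. xs ! i)"
  unfolding rec_total_def by (auto intro: eval_recf.intros)

lemma rec_total_comp:
  assumes "rec_total (length Fs) G" "\<And>F. F \<in> set Fs \<Longrightarrow> rec_total n F"
  shows "rec_total n (\<lambda>xs. G (map (\<lambda>F. F xs) Fs))"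
proof -
  obtain g where g: "length ys = length Fs \<Longrightarrow> eval_recf g ys (G ys)" for ys
    using assms(1) by (auto simp: rec_total_def)
  have "\<forall>F\<in>set Fs. \<exists>r. \<forall>xs. length xs = n \<longrightarrow> eval_recf r xs (F xs)"
    using assms(2) by (simp add: rec_total_def)
  then obtain R where R: "F \<in> set Fs \<Longrightarrow> length xs = n \<Longrightarrow> eval_recf (R F) xs (F xs)" for F xs
    by metis
  have "eval_recf (Comp g (map R Fs)) xs (G (map (\<lambda>F. F xs) Fs))" if "length xs = n" for xs
    using that by (intro eval_recf.intros(4)[where ys = "map (\<lambda>F. F xs) Fs"] g)
      (auto simp: list_all2_conv_all_nth intro: R)
  then show ?thesis unfolding rec_total_def by blast
qed

lemma rec_total_comp1:
  assumes "rec_total 1 (\<lambda>xs. g (xs ! 0))" "rec_total n F"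
  shows "rec_total n (\<lambda>xs. g (F xs))"
  using rec_total_comp[of "[F]" "\<lambda>xs. g (xs ! 0)" n] assms by simp

lemma rec_total_Suc [rec_total_intros]:
  assumes "rec_total n F"
  shows "rec_total n (\<lambda>xs. Suc (F xs))"
proof (rule rec_total_comp1[OF _ assms])
  have "eval_recf Succ xs (Suc (xs ! 0))" if "length xs = 1" for xs
    using that by (cases xs) (auto intro: eval_recf.intros)
  then show "rec_total 1 (\<lambda>xs. Suc (xs ! 0))"
    unfolding rec_total_def by blast
qed

lemma rec_total_const [rec_total_intros]: "rec_total n (\<lambda>_. c)"
  by (induction c) (auto intro: rec_total_zero rec_total_Suc)

text \<open>The step function of a primitive recursion receives the counter and the previous value
  in front of the parameters; this lemma lets it use functions of the parameters alone.\<close>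

lemma rec_total_drop2 [rec_total_intros]:
  assumes "rec_total n F"
  shows "rec_total (Suc (Suc n)) (\<lambda>ys. F (tl (tl ys)))"
proof (rule rec_total_cong)
  show "rec_total (Suc (Suc n)) (\<lambda>ys. F (map (\<lambda>F. F ys) (map (\<lambda>i ys. ys ! (i + 2)) [0..<n])))"
    using assms by (intro rec_total_comp) (auto intro!: rec_total_proj)
next
  fix ys :: "nat list" assume "length ys = Suc (Suc n)"
  then have "map (\<lambda>F. F ys) (map (\<lambda>i ys. ys ! (i + 2)) [0..<n]) = tl (tl ys)"
    by (intro nth_equalityI) (auto simp: nth_tl)
  then show "F (map (\<lambda>F. F ys) (map (\<lambda>i ys. ys ! (i + 2)) [0..<n])) = F (tl (tl ys))"
    by simp
qed

text \<open>\<open>PrimRec\<close> recurses on its first argument, whereas the bound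
  \<open>F' xs\<close> may be any recursive function of the parameters. Composition with the list of
  \<open>F'\<close> and all projections bridges the gap.\<close>

lemma rec_total_rec [rec_total_intros]:
  assumes "rec_total n F" "rec_total (Suc (Suc n)) (\<lambda>ys. g (ys ! 0) (ys ! 1) (tl (tl ys)))"
    "rec_total n F'"
  shows "rec_total n (\<lambda>xs. rec_nat (F xs) (\<lambda>k r. g k r xs) (F' xs))"
proof -
  obtain rf where rf: "length xs = n \<Longrightarrow> eval_recf rf xs (F xs)" for xs
    using assms(1) by (auto simp: rec_total_def)
  obtain rg where "length ys = Suc (Suc n) \<Longrightarrow> eval_recf rg ys (g (ys ! 0) (ys ! 1) (tl (tl ys)))" for ys
    using assms(2) by (auto simp: rec_total_def)
  from this[of "k # r # xs" for k r xs]
  have rg: "length xs = n \<Longrightarrow> eval_recf rg (k # r # xs) (g k r xs)" for k r xs by simp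
  have *: "eval_recf (PrimRec rf rg) (m # xs) (rec_nat (F xs) (\<lambda>k r. g k r xs) m)"
    if "length xs = n" for m xs
    using that by (induction m) (auto intro: eval_recf.intros rf rg)
  have "rec_total (Suc n) (\<lambda>ys. rec_nat (F (tl ys)) (\<lambda>k r. g k r (tl ys)) (ys ! 0))"
    unfolding rec_total_def
  proof (intro exI allI impI)
    fix ys :: "nat list" assume "length ys = Suc n"
    then show "eval_recf (PrimRec rf rg) ys (rec_nat (F (tl ys)) (\<lambda>k r. g k r (tl ys)) (ys ! 0))"
      using * by (cases ys) auto
  qed
  then have "rec_total n (\<lambda>xs. (\<lambda>ys. rec_nat (F (tl ys)) (\<lambda>k r. g k r (tl ys)) (ys ! 0))
     (map (\<lambda>F. F xs) (F' # map (\<lambda>i xs. xs ! i) [0..<n])))"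
    by (intro rec_total_comp) (auto intro: rec_total_proj assms(3))
  then show ?thesis
    by (rule rec_total_cong) (auto simp: map_nth comp_def)
qed

lemma rec_total_proj_intros [rec_total_intros]:
  "rec_total 1 (\<lambda>xs. xs ! 0)" "rec_total 2 (\<lambda>xs. xs ! 0)" "rec_total 2 (\<lambda>xs. xs ! 1)"
  "rec_total (Suc (Suc n)) (\<lambda>xs. xs ! 0)" "rec_total (Suc (Suc n)) (\<lambda>xs. xs ! 1)"
  by (auto intro: rec_total_proj)

lemma rec_total_if0 [rec_total_intros]:
  assumes "rec_total n F" "rec_total n F1" "rec_total n F2"
  shows "rec_total n (\<lambda>xs. if F xs = 0 then F1 xs else F2 xs)"
proof (rule rec_total_cong)
  show "rec_total n (\<lambda>xs. rec_nat (F1 xs) (\<lambda>k r. F2 xs) (F xs))"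
    by (intro rec_total_intros assms)
next
  fix xs show "rec_nat (F1 xs) (\<lambda>k r. F2 xs) (F xs) = (if F xs = 0 then F1 xs else F2 xs)"
    by (cases "F xs") auto
qed

lemma rec_total_add [rec_total_intros]:
  assumes "rec_total n F" "rec_total n F'"
  shows "rec_total n (\<lambda>xs. F xs + F' xs)"
proof (rule rec_total_cong)
  show "rec_total n (\<lambda>xs. rec_nat (F xs) (\<lambda>k r. Suc r) (F' xs))"
    by (intro rec_total_intros assms)
  have "rec_nat x (\<lambda>k r. Suc r) y = x + y" for x y :: nat by (induction y) auto
  then show "rec_nat (F xs) (\<lambda>k r. Suc r) (F' xs) = F xs + F' xs" for xs by simp
qed

lemma rec_total_diff [rec_total_intros]:
  assumes "rec_total n F" "rec_total n F'"
  shows "rec_total n (\<lambda>xs. F xs - F' xs)"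
proof (rule rec_total_cong)
  show "rec_total n (\<lambda>xs. rec_nat (F xs) (\<lambda>k r. rec_nat 0 (\<lambda>k r. k) r) (F' xs))"
    by (intro rec_total_intros assms)
  have "rec_nat 0 (\<lambda>k r. k) x = x - 1" for x :: nat by (cases x) auto
  then have "rec_nat x (\<lambda>k r. rec_nat 0 (\<lambda>k r. k) r) y = x - y" for x y :: nat
    by (induction y) auto
  then show "rec_nat (F xs) (\<lambda>k r. rec_nat 0 (\<lambda>k r. k) r) (F' xs) = F xs - F' xs" for xs by simp
qed

section \<open>The Cantor pairing function and its inverse\<close>

lemma rec_total_triangle [rec_total_intros]:
  assumes "rec_total n F"
  shows "rec_total n (\<lambda>xs. triangle (F xs))"
proof (rule rec_total_cong)
  show "rec_total n (\<lambda>xs. rec_nat 0 (\<lambda>k r. r + Suc k) (F xs))"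
    by (intro rec_total_intros assms)
  have "rec_nat 0 (\<lambda>k r. r + Suc k) x = triangle x" for x by (induction x) auto
  then show "rec_nat 0 (\<lambda>k r. r + Suc k) (F xs) = triangle (F xs)" for xs by simp
qed

lemma rec_total_prod_encode [rec_total_intros]:
  assumes "rec_total n F" "rec_total n F'"
  shows "rec_total n (\<lambda>xs. prod_encode (F xs, F' xs))"
  unfolding prod_encode_def prod.case by (intro rec_total_intros assms)

text \<open>The index of the diagonal of the Cantor enumeration that contains the given position.\<close>

definition diagonal :: "nat \<Rightarrow> nat" where
  "diagonal n = rec_nat 0 (\<lambda>k r. if triangle (Suc r) - Suc k = 0 then Suc r else r) n"

lemma diagonal_bounds: "triangle (diagonal n) \<le> n \<and> n < triangle (Suc (diagonal n))"
  unfolding diagonal_def by (induction n) auto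

lemma triangle_mono: "m \<le> n \<Longrightarrow> triangle m \<le> triangle n"
  by (induction n) (auto elim: le_SucE)

lemma diagonal_prod_encode: "diagonal (prod_encode (a, b)) = a + b"
proof -
  let ?d = "diagonal (prod_encode (a, b))"
  have *: "triangle ?d \<le> triangle (a + b) + a" "triangle (a + b) + a < triangle (Suc ?d)"
    using diagonal_bounds[of "prod_encode (a, b)"] by (auto simp: prod_encode_def)
  show ?thesis
  proof (rule linorder_cases[of ?d "a + b"])
    assume "?d < a + b"
    then show ?thesis using triangle_mono[of "Suc ?d" "a + b"] * by linarith
  next
    assume "a + b < ?d"
    then show ?thesis using triangle_mono[of "Suc (a + b)" ?d] * by simp
  qed
qed

text \<open>The code of \<open>(a, b)\<close> is \<open>triangle (a + b) + a\<close>, so the first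
  component is the offset from the start of diagonal \<open>a + b\<close>. Decoding is thereby
  reduced to operations known to be recursive.\<close>

lemma fst_prod_decode: "fst (prod_decode n) = n - triangle (diagonal n)"
proof -
  obtain a b where "n = prod_encode (a, b)" by (metis prod_decode_inverse surj_pair)
  then show ?thesis by (simp add: diagonal_prod_encode) (simp add: prod_encode_def)
qed

lemma snd_prod_decode: "snd (prod_decode n) = diagonal n - (n - triangle (diagonal n))"
proof -
  obtain a b where "n = prod_encode (a, b)" by (metis prod_decode_inverse surj_pair)
  then show ?thesis by (simp add: diagonal_prod_encode) (simp add: prod_encode_def)
qed

lemma rec_total_diagonal [rec_total_intros]:
  assumes "rec_total n F"
  shows "rec_total n (\<lambda>xs. diagonal (F xs))"
  unfolding diagonal_def by (intro rec_total_intros assms)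

lemma rec_total_prod_decode [rec_total_intros]:
  assumes "rec_total n F"
  shows "rec_total n (\<lambda>xs. fst (prod_decode (F xs)))" "rec_total n (\<lambda>xs. snd (prod_decode (F xs)))"
  unfolding fst_prod_decode snd_prod_decode by (intro rec_total_intros assms)+

section \<open>Computable functions on encodable types\<close>

class encodable =
  fixes enc :: "'a \<Rightarrow> nat"
  assumes enc_eq_iff [simp]: "enc x = enc y \<longleftrightarrow> x = y"

instantiation nat :: encodable
begin
definition enc_nat :: "nat \<Rightarrow> nat" where [simp]: "enc_nat n = n"
instance by standard simp
end

instantiation bool :: encodable
begin
definition enc_bool :: "bool \<Rightarrow> nat" where [simp]: "enc_bool b = of_bool b"
instance by standard simp
end

instantiation prod :: (encodable, encodable) encodable
begin
definition enc_prod :: "'a \<times> 'b \<Rightarrow> nat" where [simp]: "enc_prod z = prod_encode (enc (fst z), enc (snd z))"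
instance by standard (auto simp: prod_eq_iff)
end

instantiation option :: (encodable) encodable
begin
primrec enc_option :: "'a option \<Rightarrow> nat" where
  "enc_option None = 0"
| "enc_option (Some x) = Suc (enc x)"
instance
proof
  fix x y :: "'a option"
  show "enc x = enc y \<longleftrightarrow> x = y" by (cases x; cases y) auto
qed
end

instantiation list :: (encodable) encodable
begin
primrec enc_list :: "'a list \<Rightarrow> nat" where
  "enc_list [] = 0"
| "enc_list (x # xs) = Suc (prod_encode (enc x, enc_list xs))"
instance
proof
  fix xs ys :: "'a list"
  show "enc xs = enc ys \<longleftrightarrow> xs = ys"
  proof (induction xs arbitrary: ys)
    case Nil
    then show ?case by (cases ys) auto
  next
    case (Cons x xs)
    then show ?case by (cases ys) auto
  qed
qed
end

text \<open>Bounds the recursion that passes through a list: the code is available before the length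
  is known to be computable.\<close>

lemma length_le_enc: "length xs \<le> enc xs"
  by (induction xs) (auto intro: order.trans[OF _ le_prod_encode_2])

text \<open>\<open>r\<close> is recursive on all natural numbers but constrained only on codes. An
  injective \<open>enc\<close> is thus enough, with no decoder and no decision as to which numbers
  are codes.\<close>

definition tracks :: "(nat \<Rightarrow> nat) \<Rightarrow> ('a::encodable \<Rightarrow> 'b::encodable) \<Rightarrow> bool" where
  "tracks r f \<longleftrightarrow> rec_total 1 (\<lambda>xs. r (xs ! 0)) \<and> (\<forall>x. r (enc x) = enc (f x))"

definition computable :: "('a::encodable \<Rightarrow> 'b::encodable) \<Rightarrow> bool" where
  "computable f \<longleftrightarrow> (\<exists>r. tracks r f)"

named_theorems computable_intros

lemma computableI:
  assumes "rec_total 1 (\<lambda>xs. r (xs ! 0))" "\<And>x. r (enc x) = enc (f x)"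
  shows "computable f"
  using assms unfolding computable_def tracks_def by blast

lemma computableE:
  assumes "computable f"
  obtains r where "tracks r f"
  using assms unfolding computable_def by blast

lemma tracks_enc: "tracks r f \<Longrightarrow> r (enc x) = enc (f x)"
  by (simp add: tracks_def)

lemma tracks_rec_total: "tracks r f \<Longrightarrow> rec_total n F \<Longrightarrow> rec_total n (\<lambda>xs. r (F xs))"
  unfolding tracks_def by (auto intro: rec_total_comp1)

lemma computable_id [computable_intros]: "computable (\<lambda>x. x)"
  by (rule computableI[where r = "\<lambda>n. n"]) (intro rec_total_intros, simp)

lemma computable_const [computable_intros]: "computable (\<lambda>_. c)"
  by (rule computableI[where r = "\<lambda>n. enc c"]) (intro rec_total_intros, simp)

lemma computable_compose:
  assumes "computable g" "computable f"
  shows "computable (\<lambda>x. g (f x))"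
proof -
  obtain r where r: "tracks r f"
    using assms(2) by (rule computableE)
  obtain s where s: "tracks s g"
    using assms(1) by (rule computableE)
  show ?thesis
    by (rule computableI[where r = "\<lambda>n. s (r n)"]) (intro tracks_rec_total[OF r] tracks_rec_total[OF s] rec_total_intros, simp add: tracks_enc[OF r] tracks_enc[OF s])
qed

lemma computable_Pair [computable_intros]:
  assumes "computable f" "computable g"
  shows "computable (\<lambda>x. (f x, g x))"
proof -
  obtain r where r: "tracks r f"
    using assms(1) by (rule computableE)
  obtain s where s: "tracks s g"
    using assms(2) by (rule computableE)
  show ?thesis
    by (rule computableI[where r = "\<lambda>n. prod_encode (r n, s n)"])
      (intro tracks_rec_total[OF r] tracks_rec_total[OF s] rec_total_intros, simp add: tracks_enc[OF r] tracks_enc[OF s])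
qed

lemma computable_fst': "computable fst"
  by (rule computableI[where r = "\<lambda>n. fst (prod_decode n)"]) (intro rec_total_intros, simp)

lemma computable_snd': "computable snd"
  by (rule computableI[where r = "\<lambda>n. snd (prod_decode n)"]) (intro rec_total_intros, simp)

lemmas computable_fst [computable_intros] = computable_compose[OF computable_fst']
lemmas computable_snd [computable_intros] = computable_compose[OF computable_snd']

lemma computable_compose2:
  assumes "computable (\<lambda>z. g (fst z) (snd z))" "computable f" "computable h"
  shows "computable (\<lambda>x. g (f x) (h x))"
  using computable_compose[OF assms(1) computable_Pair[OF assms(2,3)]] by simp

lemma computable_compose3:
  assumes "computable (\<lambda>z. g (fst z) (fst (snd z)) (snd (snd z)))" "computable f" "computable h" "computable k"
  shows "computable (\<lambda>x. g (f x) (h x) (k x))"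
  using computable_compose[OF assms(1) computable_Pair[OF assms(2) computable_Pair[OF assms(3,4)]]]
  by simp

lemma computable_case_prod [computable_intros]:
  assumes "computable (\<lambda>x. g x (fst (h x)) (snd (h x)))"
  shows "computable (\<lambda>x. case h x of (a, b) \<Rightarrow> g x a b)"
  using assms by (simp add: split_beta)

lemma computable_if [computable_intros]:
  assumes "computable b" "computable f" "computable g"
  shows "computable (\<lambda>x. if b x then f x else g x)"
proof -
  obtain q where q: "tracks q b"
    using assms(1) by (rule computableE)
  obtain r where r: "tracks r f"
    using assms(2) by (rule computableE)
  obtain s where s: "tracks s g"
    using assms(3) by (rule computableE)
  show ?thesis
    by (rule computableI[where r = "\<lambda>n. if q n = 0 then s n else r n"])
      (intro tracks_rec_total[OF q] tracks_rec_total[OF r] tracks_rec_total[OF s] rec_total_intros,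
       simp add: tracks_enc[OF q] tracks_enc[OF r] tracks_enc[OF s])
qed

text \<open>The recursion runs on codes: \<open>prod_encode (n, prod_encode (k, a))\<close> is the
  code of parameter, counter and state, so the state may have any encodable type.\<close>

lemma computable_rec_nat [computable_intros]:
  assumes "computable f" "computable (\<lambda>z. g (fst z) (fst (snd z)) (snd (snd z)))" "computable h"
  shows "computable (\<lambda>x. rec_nat (f x) (\<lambda>k a. g x k a) (h x))"
proof -
  obtain q where q: "tracks q f"
    using assms(1) by (rule computableE)
  obtain r where r: "tracks r (\<lambda>z. g (fst z) (fst (snd z)) (snd (snd z)))"
    using assms(2) by (rule computableE)
  obtain s where s: "tracks s h"
    using assms(3) by (rule computableE)
  let ?r = "\<lambda>n. rec_nat (q n) (\<lambda>k a. r (prod_encode (n, prod_encode (k, a)))) (s n)"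
  have "rec_nat (q (enc x)) (\<lambda>k a. r (prod_encode (enc x, prod_encode (k, a)))) m
      = enc (rec_nat (f x) (\<lambda>k a. g x k a) m)" for x m
  proof (induction m)
    case (Suc m)
    then show ?case using tracks_enc[OF r, of "(x, m, rec_nat (f x) (\<lambda>k a. g x k a) m)"] by simp
  qed (simp add: tracks_enc[OF q])
  then show ?thesis
    by (intro computableI[where r = ?r]) (intro tracks_rec_total[OF q] tracks_rec_total[OF r] tracks_rec_total[OF s] rec_total_intros,
       simp add: tracks_enc[OF s])
qed

lemma computable_case_nat [computable_intros]:
  assumes "computable f" "computable (\<lambda>z. g (fst z) (snd z))" "computable h"
  shows "computable (\<lambda>x. case h x of 0 \<Rightarrow> f x | Suc n \<Rightarrow> g x n)"
proof -
  have "computable (\<lambda>x. rec_nat (f x) (\<lambda>k a. g x k) (h x))"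
    by (intro computable_intros assms computable_compose2[OF assms(2)])
  moreover have "rec_nat (f x) (\<lambda>k a. g x k) n = (case n of 0 \<Rightarrow> f x | Suc n \<Rightarrow> g x n)" for x n
    by (cases n) auto
  ultimately show ?thesis by simp
qed

lemma computable_enc [computable_intros]:
  assumes "computable f"
  shows "computable (\<lambda>x. enc (f x))"
  by (rule computable_compose[OF _ assms], rule computableI[where r = "\<lambda>n. n"])
    (intro rec_total_intros, simp)

lemma computable_Suc [computable_intros]:
  assumes "computable f"
  shows "computable (\<lambda>x. Suc (f x))"
  by (rule computable_compose[OF _ assms], rule computableI[where r = "\<lambda>n. Suc n"])
    (intro rec_total_intros, simp)

lemma computable_add [computable_intros]:
  fixes f g :: "'a::encodable \<Rightarrow> nat"
  assumes "computable f" "computable g"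
  shows "computable (\<lambda>x. f x + g x)"
proof -
  have "computable (\<lambda>x. rec_nat (f x) (\<lambda>k r. Suc r) (g x))"
    by (intro computable_intros assms)
  moreover have "rec_nat m (\<lambda>k r. Suc r) n = m + n" for m n :: nat by (induction n) auto
  ultimately show ?thesis by simp
qed

lemma computable_diff [computable_intros]:
  fixes f g :: "'a::encodable \<Rightarrow> nat"
  assumes "computable f" "computable g"
  shows "computable (\<lambda>x. f x - g x)"
proof -
  have "computable (\<lambda>x. rec_nat (f x) (\<lambda>k r. case r of 0 \<Rightarrow> 0 | Suc m \<Rightarrow> m) (g x))"
    by (intro computable_intros assms)
  moreover have "rec_nat m (\<lambda>k r. case r of 0 \<Rightarrow> 0 | Suc m \<Rightarrow> m) n = m - n" for m n :: nat
    by (induction n) (auto split: nat.splits)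
  ultimately show ?thesis by simp
qed

lemma computable_mult [computable_intros]:
  fixes f g :: "'a::encodable \<Rightarrow> nat"
  assumes "computable f" "computable g"
  shows "computable (\<lambda>x. f x * g x)"
proof -
  have "computable (\<lambda>x. rec_nat 0 (\<lambda>k r. f x + r) (g x))"
    by (intro computable_intros assms computable_compose[OF assms(1)])
  moreover have "rec_nat 0 (\<lambda>k r. m + r) n = m * n" for m n :: nat by (induction n) auto
  ultimately show ?thesis by simp
qed

lemma computable_power [computable_intros]:
  fixes f g :: "'a::encodable \<Rightarrow> nat"
  assumes "computable f" "computable g"
  shows "computable (\<lambda>x. f x ^ g x)"
proof -
  have "computable (\<lambda>x. rec_nat 1 (\<lambda>k r. f x * r) (g x))"
    by (intro computable_intros assms computable_compose[OF assms(1)])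
  moreover have "rec_nat 1 (\<lambda>k r. m * r) n = m ^ n" for m n :: nat by (induction n) auto
  ultimately show ?thesis by simp
qed

lemma computable_is_zero:
  assumes "computable f"
  shows "computable (\<lambda>x. f x = (0::nat))"
proof -
  have "computable (\<lambda>x. case f x of 0 \<Rightarrow> True | Suc n \<Rightarrow> False)"
    by (intro computable_intros assms)
  moreover have "(case n of 0 \<Rightarrow> True | Suc n \<Rightarrow> False) = (n = 0)" for n by (cases n) auto
  ultimately show ?thesis by simp
qed

lemma computable_le [computable_intros]:
  fixes f g :: "'a::encodable \<Rightarrow> nat"
  assumes "computable f" "computable g"
  shows "computable (\<lambda>x. f x \<le> g x)"
  using computable_is_zero[OF computable_diff[OF assms]] by simp

lemma computable_less [computable_intros]:
  fixes f g :: "'a::encodable \<Rightarrow> nat"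
  assumes "computable f" "computable g"
  shows "computable (\<lambda>x. f x < g x)"
  using computable_le[OF computable_Suc[OF assms(1)] assms(2)] by (simp add: Suc_le_eq)

lemma computable_conj [computable_intros]:
  assumes "computable f" "computable g"
  shows "computable (\<lambda>x. f x \<and> g x)"
  proof -
  have "computable (\<lambda>x. if f x then g x else False)"
    by (intro computable_intros assms)
  also have "(\<lambda>x. if f x then g x else False) = (\<lambda>x. f x \<and> g x)" by auto
  finally show ?thesis .
qed

lemma computable_disj [computable_intros]:
  assumes "computable f" "computable g"
  shows "computable (\<lambda>x. f x \<or> g x)"
  proof -
  have "computable (\<lambda>x. if f x then True else g x)"
    by (intro computable_intros assms)
  also have "(\<lambda>x. if f x then True else g x) = (\<lambda>x. f x \<or> g x)" by auto
  finally show ?thesis .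
qed

lemma computable_Not [computable_intros]:
  assumes "computable f"
  shows "computable (\<lambda>x. \<not> f x)"
  proof -
  have "computable (\<lambda>x. if f x then False else True)"
    by (intro computable_intros assms)
  also have "(\<lambda>x. if f x then False else True) = (\<lambda>x. \<not> f x)" by auto
  finally show ?thesis .
qed

lemma computable_eq [computable_intros]:
  assumes "computable f" "computable g"
  shows "computable (\<lambda>x. f x = g x)"
proof -
  have "computable (\<lambda>x. enc (f x) \<le> enc (g x) \<and> enc (g x) \<le> enc (f x))"
    by (intro computable_intros assms)
  then show ?thesis by (simp flip: order.eq_iff)
qed

section \<open>Options, lists and finite tables\<close>

lemma computable_Some [computable_intros]:
  assumes "computable f"
  shows "computable (\<lambda>x. Some (f x))"
  by (rule computable_compose[OF _ assms], rule computableI[where r = "\<lambda>n. Suc n"])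
    (intro rec_total_intros, simp)

text \<open>\<open>None\<close> has code 0 and \<open>Some y\<close> a successor as code, so the
  case distinction is a zero test followed by a predecessor.\<close>

lemma computable_case_option [computable_intros]:
  assumes "computable f" "computable (\<lambda>z. g (fst z) (snd z))" "computable h"
  shows "computable (\<lambda>x. case h x of None \<Rightarrow> f x | Some y \<Rightarrow> g x y)"
proof -
  obtain q where q: "tracks q f"
    using assms(1) by (rule computableE)
  obtain r where r: "tracks r (\<lambda>z. g (fst z) (snd z))"
    using assms(2) by (rule computableE)
  obtain s where s: "tracks s h"
    using assms(3) by (rule computableE)
  have "rec_total 1 (\<lambda>xs. if s (xs ! 0) = 0 then q (xs ! 0) else r (prod_encode (xs ! 0, s (xs ! 0) - 1)))"
    by (intro tracks_rec_total[OF q] tracks_rec_total[OF r] tracks_rec_total[OF s] rec_total_intros)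
  then show ?thesis
  proof (rule computableI[where r = "\<lambda>n. if s n = 0 then q n else r (prod_encode (n, s n - 1))"])
    fix x
    show "(if s (enc x) = 0 then q (enc x) else r (prod_encode (enc x, s (enc x) - 1)))
        = enc (case h x of None \<Rightarrow> f x | Some y \<Rightarrow> g x y)"
      using tracks_enc[OF r, of "(x, the (h x))"] by (cases "h x") (auto simp: tracks_enc[OF q] tracks_enc[OF s])
  qed
qed

lemma computable_Cons [computable_intros]:
  assumes "computable f" "computable g"
  shows "computable (\<lambda>x. f x # g x)"
  by (rule computable_compose2[OF _ assms], rule computableI[where r = "\<lambda>n. Suc n"])
    (intro rec_total_intros, simp)

lemma computable_case_list [computable_intros]:
  assumes "computable f" "computable (\<lambda>z. g (fst z) (fst (snd z)) (snd (snd z)))" "computable h"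
  shows "computable (\<lambda>x. case h x of [] \<Rightarrow> f x | y # ys \<Rightarrow> g x y ys)"
proof -
  obtain q where q: "tracks q f"
    using assms(1) by (rule computableE)
  obtain r where r: "tracks r (\<lambda>z. g (fst z) (fst (snd z)) (snd (snd z)))"
    using assms(2) by (rule computableE)
  obtain s where s: "tracks s h"
    using assms(3) by (rule computableE)
  have "rec_total 1 (\<lambda>xs. if s (xs ! 0) = 0 then q (xs ! 0) else r (prod_encode (xs ! 0, s (xs ! 0) - 1)))"
    by (intro tracks_rec_total[OF q] tracks_rec_total[OF r] tracks_rec_total[OF s] rec_total_intros)
  then show ?thesis
  proof (rule computableI[where r = "\<lambda>n. if s n = 0 then q n else r (prod_encode (n, s n - 1))"])
    fix x
    show "(if s (enc x) = 0 then q (enc x) else r (prod_encode (enc x, s (enc x) - 1)))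
        = enc (case h x of [] \<Rightarrow> f x | y # ys \<Rightarrow> g x y ys)"
      using tracks_enc[OF r, of "(x, hd (h x), tl (h x))"] by (cases "h x") (auto simp: tracks_enc[OF q] tracks_enc[OF s])
  qed
qed

lemma computable_tl [computable_intros]:
  assumes "computable f"
  shows "computable (\<lambda>x. tl (f x))"
  unfolding tl_def by (intro computable_intros assms)

text \<open>The state holds the accumulator and the unread rest of the list. There are at least as
  many iterations as entries, and the surplus ones are idle because the rest is empty.\<close>

lemma computable_foldl [computable_intros]:
  assumes "computable f" "computable (\<lambda>z. g (fst z) (fst (snd z)) (snd (snd z)))" "computable h"
  shows "computable (\<lambda>x. foldl (\<lambda>a y. g x a y) (f x) (h x))"
proof -
  let ?it = "\<lambda>x. rec_nat (f x, h x) (\<lambda>k r. case snd r of [] \<Rightarrow> r | y # ys \<Rightarrow> (g x (fst r) y, ys))"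
  have "computable (\<lambda>x. fst (?it x (enc (h x))))"
    by (intro computable_intros assms computable_compose3[OF assms(2)])
  moreover have "?it x n = (foldl (g x) (f x) (take n (h x)), drop n (h x))" for x n
  proof (induction n)
    case (Suc n)
    show ?case
    proof (cases "n < length (h x)")
      case True
      then have "drop n (h x) = h x ! n # drop (Suc n) (h x)" by (simp add: Cons_nth_drop_Suc)
      then show ?thesis using Suc True by (simp add: take_Suc_conv_app_nth)
    qed (use Suc in simp)
  qed simp
  ultimately show ?thesis by (simp add: length_le_enc)
qed

lemma computable_rev [computable_intros]:
  assumes "computable f"
  shows "computable (\<lambda>x. rev (f x))"
proof -
  have "computable (\<lambda>x. foldl (\<lambda>a y. y # a) [] (f x))"
    by (intro computable_intros assms)
  moreover have "foldl (\<lambda>a y. y # a) ys xs = rev xs @ ys" for xs ys :: "'b list"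
    by (induction xs arbitrary: ys) auto
  ultimately show ?thesis by simp
qed

lemma computable_append [computable_intros]:
  assumes "computable f" "computable g"
  shows "computable (\<lambda>x. f x @ g x)"
proof -
  have "computable (\<lambda>x. foldl (\<lambda>a y. y # a) (g x) (rev (f x)))"
    by (intro computable_intros assms)
  moreover have "foldl (\<lambda>a y. y # a) ys xs = rev xs @ ys" for xs ys :: "'b list"
    by (induction xs arbitrary: ys) auto
  ultimately show ?thesis by simp
qed

lemma computable_map [computable_intros]:
  assumes "computable (\<lambda>z. g (fst z) (snd z))" "computable f"
  shows "computable (\<lambda>x. map (\<lambda>y. g x y) (f x))"
proof -
  have "computable (\<lambda>x. foldl (\<lambda>a y. a @ [g x y]) [] (f x))"
    by (intro computable_intros assms computable_compose2[OF assms(1)])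
  moreover have "foldl (\<lambda>a y. a @ [g x y]) ys xs = ys @ map (g x) xs" for xs ys x
    by (induction xs arbitrary: ys) auto
  ultimately show ?thesis by simp
qed

lemma computable_filter [computable_intros]:
  assumes "computable (\<lambda>z. g (fst z) (snd z))" "computable f"
  shows "computable (\<lambda>x. filter (\<lambda>y. g x y) (f x))"
proof -
  have "computable (\<lambda>x. foldl (\<lambda>a y. if g x y then a @ [y] else a) [] (f x))"
    by (intro computable_intros assms computable_compose2[OF assms(1)])
  moreover have "foldl (\<lambda>a y. if g x y then a @ [y] else a) ys xs = ys @ filter (g x) xs" for xs ys x
    by (induction xs arbitrary: ys) auto
  ultimately show ?thesis by simp
qed

lemma computable_takeWhile [computable_intros]:
  assumes "computable (\<lambda>z. g (fst z) (snd z))" "computable f"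
  shows "computable (\<lambda>x. takeWhile (\<lambda>y. g x y) (f x))"
proof -
  have "computable (\<lambda>x. snd (foldl (\<lambda>a y. if fst a \<and> g x y then (True, snd a @ [y]) else (False, snd a))
      (True, []) (f x)))"
    by (intro computable_intros assms computable_compose2[OF assms(1)])
  moreover have "snd (foldl (\<lambda>a y. if fst a \<and> g x y then (True, snd a @ [y]) else (False, snd a)) (b, ys) xs)
      = ys @ (if b then takeWhile (g x) xs else [])" for xs ys x b
    by (induction xs arbitrary: ys b) auto
  ultimately show ?thesis by simp
qed

lemma computable_concat [computable_intros]:
  assumes "computable f"
  shows "computable (\<lambda>x. concat (f x))"
proof -
  have "computable (\<lambda>x. foldl (\<lambda>a y. a @ y) [] (f x))"
    by (intro computable_intros assms)
  moreover have "foldl (\<lambda>a y. a @ y) ys xs = ys @ concat xs" for xs and ys :: "'b list"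
    by (induction xs arbitrary: ys) auto
  ultimately show ?thesis by simp
qed

lemma computable_sum_list [computable_intros]:
  fixes f :: "'a::encodable \<Rightarrow> nat list"
  assumes "computable f"
  shows "computable (\<lambda>x. sum_list (f x))"
proof -
  have "computable (\<lambda>x. foldl (\<lambda>a y. a + y) 0 (f x))"
    by (intro computable_intros assms)
  moreover have "foldl (\<lambda>a y. a + y) m xs = m + sum_list xs" for m and xs :: "nat list"
    by (induction xs arbitrary: m) auto
  ultimately show ?thesis by simp
qed

lemma computable_length [computable_intros]:
  assumes "computable f"
  shows "computable (\<lambda>x. length (f x))"
proof -
  have "computable (\<lambda>x. sum_list (map (\<lambda>y. 1 :: nat) (f x)))"
    by (intro computable_intros assms)
  then show ?thesis by (simp add: sum_list_triv)
qed

lemma computable_drop [computable_intros]: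
  assumes "computable f" "computable g"
  shows "computable (\<lambda>x. drop (g x) (f x))"
proof -
  have "computable (\<lambda>x. rec_nat (f x) (\<lambda>k r. tl r) (g x))"
    by (intro computable_intros assms)
  moreover have "rec_nat xs (\<lambda>k r. tl r) n = drop n xs" for xs :: "'b list" and n
    by (induction n) (auto simp: drop_Suc tl_drop)
  ultimately show ?thesis by simp
qed

lemma computable_take [computable_intros]:
  assumes "computable f" "computable g"
  shows "computable (\<lambda>x. take (g x) (f x))"
proof -
  have "computable (\<lambda>x. rev (drop (length (f x) - g x) (rev (f x))))"
    by (intro computable_intros assms)
  moreover have "rev (drop (length xs - n) (rev xs)) = take n xs" for xs :: "'b list" and n
    by (cases "n \<le> length xs") (simp_all add: rev_drop)
  ultimately show ?thesis by simp
qed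

lemma computable_upt [computable_intros]:
  assumes "computable f" "computable g"
  shows "computable (\<lambda>x. [f x..<g x])"
proof -
  have "computable (\<lambda>x. rec_nat [] (\<lambda>k r. if k < f x then r else r @ [k]) (g x))"
    by (intro computable_intros assms computable_compose[OF assms(1)])
  moreover have "rec_nat [] (\<lambda>k r. if k < m then r else r @ [k]) n = [m..<n]" for m n
    by (induction n) auto
  ultimately show ?thesis by simp
qed

lemma computable_list_ex [computable_intros]:
  assumes "computable (\<lambda>z. g (fst z) (snd z))" "computable f"
  shows "computable (\<lambda>x. list_ex (\<lambda>y. g x y) (f x))"
proof -
  have "computable (\<lambda>x. filter (\<lambda>y. g x y) (f x) \<noteq> [])"
    by (intro computable_intros assms)
  then show ?thesis by (simp add: list_ex_iff filter_empty_conv)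
qed

lemma computable_prefix [computable_intros]:
  assumes "computable f" "computable g"
  shows "computable (\<lambda>x. prefix (f x) (g x))"
proof -
  have "computable (\<lambda>x. take (length (f x)) (g x) = f x)"
    by (intro computable_intros assms)
  moreover have "take (length xs) ys = xs \<longleftrightarrow> prefix xs ys" for xs ys :: "'b list"
    by (metis append_take_drop_id prefix_def append_eq_conv_conj)
  ultimately show ?thesis by simp
qed

lemma computable_n_lists [computable_intros]:
  assumes "computable f" "computable g"
  shows "computable (\<lambda>x. List.n_lists (f x) (g x))"
proof -
  have "computable (\<lambda>x. rec_nat [[]] (\<lambda>k r. concat (map (\<lambda>ys. map (\<lambda>y. y # ys) (g x)) r)) (f x))"
    by (intro computable_intros assms computable_compose[OF assms(2)])
  moreover have "rec_nat [[]] (\<lambda>k r. concat (map (\<lambda>ys. map (\<lambda>y. y # ys) xs) r)) n = List.n_lists n xs"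
    for n and xs :: "'b list"
    by (induction n) auto
  ultimately show ?thesis by simp
qed

text \<open>A finite table is computable whatever function \<open>g\<close> it is taken from. This
  is how the transition function of a machine, an arbitrary function on infinite types, becomes
  computable.\<close>

lemma computable_finite_support:
  fixes g :: "'a::encodable \<Rightarrow> 'b::encodable"
  assumes "finite S"
  shows "computable (\<lambda>x. if x \<in> S then g x else d)"
  using assms
proof (induction S rule: finite_induct)
  case empty
  then show ?case by (simp add: computable_const)
next
  case (insert a S)
  have "computable (\<lambda>x. if x = a then g a else if x \<in> S then g x else d)"
    by (intro computable_intros insert.IH)
  also have "(\<lambda>x. if x = a then g a else if x \<in> S then g x else d)
      = (\<lambda>x. if x \<in> insert a S then g x else d)"
    by auto
  finally show ?case .
qed

section \<open>Step-bounded evaluation\<close>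

text \<open>The bound limits only the searches of \<^const>\<open>Mu\<close>: all other schemes terminate by themselves.\<close>

fun eval_within :: "recf \<Rightarrow> nat \<Rightarrow> nat list \<Rightarrow> nat option" where
  "eval_within Zero t xs = Some 0"
| "eval_within Succ t xs = (case xs of [] \<Rightarrow> None | x # ys \<Rightarrow> if ys = [] then Some (Suc x) else None)"
| "eval_within (Proj i) t xs = (case drop i xs of [] \<Rightarrow> None | y # ys \<Rightarrow> Some y)"
| "eval_within (Comp f gs) t xs =
    (case those (map (\<lambda>g. eval_within g t xs) gs) of None \<Rightarrow> None | Some ys \<Rightarrow> eval_within f t ys)"
| "eval_within (PrimRec f g) t xs =
    (case xs of [] \<Rightarrow> None
     | n # zs \<Rightarrow> rec_nat (eval_within f t zs)
        (\<lambda>k r. case r of None \<Rightarrow> None | Some y \<Rightarrow> eval_within g t (k # y # zs)) n)"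
| "eval_within (Mu f) t xs =
    (case filter (\<lambda>n. eval_within f t (n # xs) = Some 0 \<and>
        \<not> list_ex (\<lambda>k. eval_within f t (k # xs) = None \<or> eval_within f t (k # xs) = Some 0) [0..<n]) [0..<t]
     of [] \<Rightarrow> None | n # ns \<Rightarrow> Some n)"

text \<open>The list \<open>gs\<close> is a fixed part of a term and not an input, so the induction
  on it takes place outside the computed function.\<close>

lemma computable_those:
  assumes "\<And>g. g \<in> set gs \<Longrightarrow> computable (F g)"
  shows "computable (\<lambda>x. those (map (\<lambda>g. F g x) gs))"
  using assms
proof (induction gs)
  case Nil
  then show ?case by (simp add: computable_const)
next
  case (Cons g gs)
  note c = computable_compose[OF Cons.prems[of g, simplified]] computable_compose[OF Cons.IH[OF Cons.prems]]
  have "computable (\<lambda>x. case F g x of None \<Rightarrow> None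
      | Some y \<Rightarrow> (case those (map (\<lambda>g. F g x) gs) of None \<Rightarrow> None | Some ys \<Rightarrow> Some (y # ys)))"
    by (intro computable_intros c) auto
  then show ?case by (simp add: map_option_case cong: option.case_cong)
qed

text \<open>The term \<open>f\<close> is fixed: structural induction yields a separate computable
  function for each term, and terms are never coded as numbers.\<close>

lemma computable_eval_within: "computable (\<lambda>z. eval_within f (fst z) (snd z))"
proof (induction f)
  case (Comp f gs)
  note c = computable_compose2[OF Comp.IH(1)] computable_those[OF Comp.IH(2)]
  show ?case
    unfolding eval_within.simps by (intro computable_intros c)
next
  case (PrimRec f g)
  note c = computable_compose2[OF PrimRec.IH(1)] computable_compose2[OF PrimRec.IH(2)]
  show ?case
    unfolding eval_within.simps by (intro computable_intros c)
next
  case (Mu f)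
  note c = computable_compose2[OF Mu.IH]
  show ?case
    unfolding eval_within.simps by (intro computable_intros c)
qed (unfold eval_within.simps, (intro computable_intros)+)

lemma those_eq_Some_iff: "those xs = Some ys \<longleftrightarrow> list_all2 (\<lambda>x y. x = Some y) xs ys"
proof (induction xs arbitrary: ys)
  case (Cons x xs)
  then show ?case by (cases ys) (auto split: option.splits)
qed (auto)

text \<open>The conditions determine \<open>n\<close>: a smaller solution would have value 0 where a
  positive value is demanded. The head of the filtered list is therefore its only entry.\<close>

lemma eval_within_Mu_iff:
  "eval_within (Mu f) t xs = Some n \<longleftrightarrow>
    n < t \<and> eval_within f t (n # xs) = Some 0 \<and> (\<forall>k<n. \<exists>y>0. eval_within f t (k # xs) = Some y)"
proof -
  define P where "P n \<longleftrightarrow> eval_within f t (n # xs) = Some 0 \<and>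
      (\<forall>k<n. \<exists>y>0. eval_within f t (k # xs) = Some y)" for n
  have pos: "(\<exists>y>0. z = Some y) \<longleftrightarrow> \<not> (z = None \<or> z = Some 0)" for z :: "nat option"
    by (cases z) auto
  have eq: "eval_within (Mu f) t xs =
      (case filter P [0..<t] of [] \<Rightarrow> None | n # ns \<Rightarrow> Some n)"
    unfolding eval_within.simps
    by (intro arg_cong[where f = "\<lambda>l. case l of [] \<Rightarrow> None | n # ns \<Rightarrow> Some n"] filter_cong refl)
      (auto simp: P_def list_ex_iff pos)
  have unique: "m = n" if "P m" "P n" for m n
    using that unfolding P_def by (metis linorder_neqE_nat less_irrefl option.inject)
  show ?thesis
  proof
    assume "eval_within (Mu f) t xs = Some n"
    then obtain ns where "filter P [0..<t] = n # ns" by (auto simp: eq simp del: eval_within.simps split: list.splits)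
    then have "n \<in> set (filter P [0..<t])" by simp
    then show "n < t \<and> eval_within f t (n # xs) = Some 0 \<and> (\<forall>k<n. \<exists>y>0. eval_within f t (k # xs) = Some y)"
      by (auto simp: P_def)
  next
    assume "n < t \<and> eval_within f t (n # xs) = Some 0 \<and> (\<forall>k<n. \<exists>y>0. eval_within f t (k # xs) = Some y)"
    then have n: "n < t" "P n" by (auto simp: P_def)
    then have "n \<in> set (filter P [0..<t])" by simp
    then obtain m ns where m: "filter P [0..<t] = m # ns" by (cases "filter P [0..<t]") auto
    then have "m \<in> set (filter P [0..<t])" by simp
    then have "P m" by simp
    then show "eval_within (Mu f) t xs = Some n" using m unique n by (simp add: eq del: eval_within.simps)
  qed
qed

lemma eval_within_mono:
  assumes "eval_within f t xs = Some y" "t \<le> t'"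
  shows "eval_within f t' xs = Some y"
  using assms
proof (induction f arbitrary: xs y)
  case (Comp f gs)
  from Comp.prems(1) obtain ys where ys: "those (map (\<lambda>g. eval_within g t xs) gs) = Some ys"
    "eval_within f t ys = Some y" by (auto split: option.splits)
  have "those (map (\<lambda>g. eval_within g t' xs) gs) = Some ys"
    using ys(1) Comp.IH(2) Comp.prems(2) unfolding those_eq_Some_iff
    by (auto simp: list_all2_conv_all_nth)
  then show ?case using Comp.IH(1)[OF ys(2) Comp.prems(2)] by simp
next
  case (PrimRec f g)
  from PrimRec.prems(1) obtain n zs where xs: "xs = n # zs" by (auto split: list.splits)
  let ?R = "\<lambda>t. rec_nat (eval_within f t zs)
        (\<lambda>k r. case r of None \<Rightarrow> None | Some y \<Rightarrow> eval_within g t (k # y # zs))"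
  have "?R t n = Some y \<Longrightarrow> ?R t' n = Some y"
    using PrimRec.prems(2) by (induction n arbitrary: y) (auto split: option.splits intro: PrimRec.IH)
  then show ?case using PrimRec.prems(1) by (simp add: xs)
next
  case (Mu f)
  then show ?case unfolding eval_within_Mu_iff by (meson less_le_trans)
qed (auto)

lemma eval_within_sound: "eval_within f t xs = Some y \<Longrightarrow> eval_recf f xs y"
proof (induction f arbitrary: xs y)
  case Zero
  then show ?case by (auto intro: eval_recf.intros)
next
  case Succ
  then show ?case by (auto intro: eval_recf.intros split: list.splits if_splits)
next
  case (Proj i)
  then have i: "drop i xs \<noteq> []" "y = hd (drop i xs)" by (auto split: list.splits)
  then have "y = xs ! i" "i < length xs" by (auto simp: hd_drop_conv_nth)
  then show ?case by (auto intro: eval_recf.intros)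
next
  case (Comp f gs)
  from Comp.prems(1) obtain ys where ys: "those (map (\<lambda>g. eval_within g t xs) gs) = Some ys"
    "eval_within f t ys = Some y" by (auto split: option.splits)
  have "list_all2 (\<lambda>g y. eval_recf g xs y) gs ys"
    using ys(1) Comp.IH(2) unfolding those_eq_Some_iff by (auto simp: list_all2_conv_all_nth)
  then show ?case using Comp.IH(1)[OF ys(2)] by (rule eval_recf.intros)
next
  case (PrimRec f g)
  from PrimRec.prems(1) obtain n zs where xs: "xs = n # zs" by (auto split: list.splits)
  have "rec_nat (eval_within f t zs)
        (\<lambda>k r. case r of None \<Rightarrow> None | Some y \<Rightarrow> eval_within g t (k # y # zs)) n = Some y
      \<Longrightarrow> eval_recf (PrimRec f g) (n # zs) y"
    by (induction n arbitrary: y) (auto split: option.splits intro: PrimRec.IH eval_recf.intros)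
  then show ?case using PrimRec.prems(1) by (simp add: xs)
next
  case (Mu f)
  then show ?case unfolding eval_within_Mu_iff by (meson eval_recf.intros(7))
qed

text \<open>Each rule depends on finitely many evaluations, so by monotonicity the maximum of their
  bounds serves all of them.\<close>

lemma eval_within_complete: "eval_recf f xs y \<Longrightarrow> \<exists>t. eval_within f t xs = Some y"
proof (induction rule: eval_recf.induct)
  case (2 x)
  then show ?case by simp
next
  case (3 i xs)
  then show ?case by (auto simp flip: Cons_nth_drop_Suc)
next
  case (4 xs gs ys f z)
  have "\<forall>i<length gs. \<exists>t. eval_within (gs ! i) t xs = Some (ys ! i)"
    using 4(1) by (auto simp: list_all2_conv_all_nth)
  then obtain T where T: "\<And>i. i < length gs \<Longrightarrow> eval_within (gs ! i) (T i) xs = Some (ys ! i)"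
    by metis
  obtain t0 where t0: "eval_within f t0 ys = Some z" using "4.IH"(2) by blast
  define t where "t = Max (insert t0 (T ` {..<length gs}))"
  have t: "t0 \<le> t" "\<And>i. i < length gs \<Longrightarrow> T i \<le> t" by (auto simp: t_def)
  have "those (map (\<lambda>g. eval_within g t xs) gs) = Some ys"
    unfolding those_eq_Some_iff using 4(1) eval_within_mono[OF T t(2)]
    by (auto simp: list_all2_conv_all_nth)
  moreover have "eval_within f t ys = Some z" by (rule eval_within_mono[OF t0 t(1)])
  ultimately show ?case by (intro exI[of _ t]) simp
next
  case (6 f g n xs y z)
  obtain t0 t1 where t: "eval_within (PrimRec f g) t0 (n # xs) = Some y"
    "eval_within g t1 (n # y # xs) = Some z" using "6.IH" by blast
  define t where "t = max t0 t1"
  have "eval_within (PrimRec f g) t (n # xs) = Some y" "eval_within g t (n # y # xs) = Some z"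
    by (rule eval_within_mono[OF t(1)], simp add: t_def) (rule eval_within_mono[OF t(2)], simp add: t_def)
  then have "eval_within (PrimRec f g) t (Suc n # xs) = Some z" by simp
  then show ?case by blast
next
  case (7 f n xs)
  have "\<forall>k. \<exists>t. k < n \<longrightarrow> (\<exists>y>0. eval_within f t (k # xs) = Some y)"
    using "7.IH"(2) by blast
  then obtain T where T: "\<And>k. k < n \<Longrightarrow> \<exists>y>0. eval_within f (T k) (k # xs) = Some y"
    by metis
  obtain t0 where t0: "eval_within f t0 (n # xs) = Some 0" using "7.IH"(1) by blast
  \<comment> \<open>\<open>Suc n\<close> is included because the search inspects only numbers below
    \<open>t\<close>.\<close>
  define t where "t = max (Suc n) (Max (insert t0 (T ` {..<n})))"
  have t: "n < t" "t0 \<le> t" "\<And>i. i < n \<Longrightarrow> T i \<le> t" by (auto simp: t_def intro!: max.coboundedI2 Max_ge)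
  have "\<exists>y>0. eval_within f t (k # xs) = Some y" if "k < n" for k
    using T[OF that] eval_within_mono[OF _ t(3)[OF that]] by blast
  then have "eval_within (Mu f) t xs = Some n"
    unfolding eval_within_Mu_iff using t(1) eval_within_mono[OF t0 t(2)] by blast
  then show ?case by blast
qed (auto)

section \<open>Binary strings and partial recursive functions\<close>

lemma computable_odd [computable_intros]:
  assumes "computable f"
  shows "computable (\<lambda>x. odd (f x :: nat))"
proof -
  have "computable (\<lambda>x. rec_nat False (\<lambda>k r. \<not> r) (f x))"
    by (intro computable_intros assms)
  moreover have "rec_nat False (\<lambda>k r. \<not> r) n = odd n" for n by (induction n) auto
  ultimately show ?thesis by simp
qed

lemma computable_half [computable_intros]:
  assumes "computable f"
  shows "computable (\<lambda>x. (f x :: nat) div 2)"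
proof -
  have "computable (\<lambda>x. rec_nat 0 (\<lambda>k r. if odd k then Suc r else r) (f x))"
    by (intro computable_intros assms)
  moreover have "rec_nat 0 (\<lambda>k r. if odd k then Suc r else r) n = n div 2" for n
    by (induction n) auto
  ultimately show ?thesis by simp
qed

text \<open>The recursion goes from \<open>n\<close> to \<open>n div 2\<close> and is simulated by
  iterated halving; as many iterations as the number itself suffice, and those after reaching 0 are
  idle.\<close>

lemma computable_binary_numeral [computable_intros]:
  assumes "computable f"
  shows "computable (\<lambda>x. binary_numeral (f x))"
proof -
  let ?it = "\<lambda>m bs. rec_nat (m, bs) (\<lambda>k r. if fst r = 0 then r else (fst r div 2, odd (fst r) # snd r))"
  have "computable (\<lambda>x. snd (?it (f x) [] (f x)))"
    by (intro computable_intros assms)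
  moreover have "binary_numeral m @ bs = snd (?it m bs n)" if "m \<le> n" for m n bs
    using that
  proof (induction n arbitrary: m bs)
    case 0
    then show ?case by (simp add: binary_numeral.simps)
  next
    case (Suc n)
    \<comment> \<open>\<open>rec_nat\<close> unfolds at the last iteration, whereas the recursion of
      \<open>binary_numeral\<close> needs the first one split off.\<close>
    have shift: "?it m bs (Suc n) = ?it (m div 2) (odd m # bs) n" if "m \<noteq> 0"
      using that by (induction n) auto
    show ?case
    proof (cases "m = 0")
      case True
      then have "?it m bs (Suc n) = (0, bs)" by (induction n) auto
      then show ?thesis using True by (simp add: binary_numeral.simps)
    next
      case False
      then have "m div 2 \<le> n" using Suc.prems by linarith
      then show ?thesis
        using Suc.IH[of "m div 2" "odd m # bs"] False shift[OF False]
        by (subst binary_numeral.simps) simp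
    qed
  qed
  from this[of m m "[]" for m] have "snd (?it m [] m) = binary_numeral m" for m by simp
  ultimately show ?thesis by simp
qed

lemma computable_string_code [computable_intros]:
  assumes "computable f"
  shows "computable (\<lambda>x. string_code (f x))"
  unfolding string_code_def by (intro computable_intros assms)

text \<open>The length-lexicographic position of \<open>s\<close>, plus one, is the number written
  as 1 followed by \<open>s\<close>. Dropping the leading digit thus inverts
  \<open>string_code\<close> computably.\<close>

lemma binary_numeral_string_code: "binary_numeral (Suc (string_code s)) = True # s"
proof (induction s rule: rev_induct)
  case Nil
  then show ?case by (simp add: binary_numeral.simps)
next
  case (snoc b s)
  have "Suc (string_code (s @ [b])) div 2 = Suc (string_code s)"
    "odd (Suc (string_code (s @ [b]))) = b" by auto
  then show ?case by (subst binary_numeral.simps) (simp add: snoc)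
qed

lemma computable_eval_recf2:
  assumes "computable (\<lambda>z. F (fst z) (snd z) :: nat)"
  shows "\<exists>r. \<forall>a b. eval_recf r [a, b] (F a b)"
proof -
  obtain q where q: "tracks q (\<lambda>z. F (fst z) (snd z))" using assms by (rule computableE)
  have "rec_total 2 (\<lambda>xs. q (prod_encode (xs ! 0, xs ! 1)))"
    by (intro tracks_rec_total[OF q] rec_total_intros)
  then obtain r where r: "length xs = 2 \<Longrightarrow> eval_recf r xs (q (prod_encode (xs ! 0, xs ! 1)))" for xs
    unfolding rec_total_def by blast
  have "q (prod_encode (a, b)) = F a b" for a b using tracks_enc[OF q, of "(a, b)"] by simp
  then have "eval_recf r [a, b] (F a b)" for a b using r[of "[a, b]"] by simp
  then show ?thesis by blast
qed

text \<open>\<open>Mu\<close> returns the successful stage and not the output. A second term,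
  composed with it, recomputes the output from stage and input.\<close>

lemma partial_recursive_search:
  fixes G :: "bool list \<Rightarrow> nat \<Rightarrow> bool list option"
  assumes "computable (\<lambda>z. G (fst z) (snd z))"
  shows "partial_recursive (\<lambda>p. if \<exists>s. G p s \<noteq> None then G p (LEAST s. G p s \<noteq> None) else None)"
    (is "partial_recursive ?C")
proof -
  define dec where "dec c = tl (binary_numeral (Suc c))" for c
  have dec: "dec (string_code p) = p" for p
    by (simp add: dec_def binary_numeral_string_code)
  \<comment> \<open>Success is coded by 0 because \<open>Mu\<close> searches for a zero.\<close>
  define test where "test s c = (case G (dec c) s of None \<Rightarrow> 1 | Some x \<Rightarrow> (0 :: nat))" for s c
  define out where "out s c = (case G (dec c) s of None \<Rightarrow> 0 | Some x \<Rightarrow> string_code x)" for s c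
  have "computable (\<lambda>z. test (fst z) (snd z))"
    unfolding test_def dec_def by (intro computable_intros computable_compose2[OF assms])
  then obtain rt where rt: "\<And>s c. eval_recf rt [s, c] (test s c)"
    using computable_eval_recf2 by blast
  have "computable (\<lambda>z. out (fst z) (snd z))"
    unfolding out_def dec_def by (intro computable_intros computable_compose2[OF assms])
  then obtain ro where ro: "\<And>s c. eval_recf ro [s, c] (out s c)"
    using computable_eval_recf2 by blast
  have test: "test s (string_code p) = 0 \<longleftrightarrow> G p s \<noteq> None" for s p
    by (auto simp: test_def dec split: option.splits)
  have search: "eval_recf (Mu rt) [string_code p] s \<longleftrightarrow> G p s \<noteq> None \<and> s = (LEAST s. G p s \<noteq> None)" for p s
  proof
    assume "eval_recf (Mu rt) [string_code p] s"
    then have s: "eval_recf rt [s, string_code p] 0"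
      "\<And>k. k < s \<Longrightarrow> \<exists>y>0. eval_recf rt [k, string_code p] y"
      by (auto elim: eval_recf_MuE)
    have "G p s \<noteq> None" using eval_recf_deterministic[OF s(1) rt] test by metis
    moreover have "G p k = None" if "k < s" for k
      using s(2)[OF that] eval_recf_deterministic[OF _ rt] test by (metis less_irrefl)
    ultimately show "G p s \<noteq> None \<and> s = (LEAST s. G p s \<noteq> None)"
      by (intro conjI sym[OF Least_equality]) (auto simp: not_less[symmetric])
  next
    assume s: "G p s \<noteq> None \<and> s = (LEAST s. G p s \<noteq> None)"
    show "eval_recf (Mu rt) [string_code p] s"
    proof (rule eval_recf.intros)
      show "eval_recf rt [s, string_code p] 0" using rt[of s "string_code p"] test[of s p] s by metis
      fix k assume "k < s"
      then have "G p k = None" using s not_less_Least by blast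
      then show "\<exists>y>0. eval_recf rt [k, string_code p] y"
        using rt[of k "string_code p"] test[of k p] by blast
    qed
  qed
  have "?C p = Some x \<longleftrightarrow> eval_recf (Comp ro [Mu rt, Proj 0]) [string_code p] (string_code x)" for p x
  proof
    assume C: "?C p = Some x"
    define s where "s = (LEAST s. G p s \<noteq> None)"
    have s: "G p s = Some x" using C by (auto simp: s_def split: if_splits)
    show "eval_recf (Comp ro [Mu rt, Proj 0]) [string_code p] (string_code x)"
    proof (rule eval_recf.intros)
      show "list_all2 (\<lambda>g y. eval_recf g [string_code p] y) [Mu rt, Proj 0] [s, string_code p]"
        using search[of p s] s eval_recf.intros(3)[of 0 "[string_code p]"] by (simp add: s_def)
      show "eval_recf ro [s, string_code p] (string_code x)"
        using ro[of s "string_code p"] s by (simp add: out_def dec)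
    qed
  next
    assume "eval_recf (Comp ro [Mu rt, Proj 0]) [string_code p] (string_code x)"
    then obtain ys where ys: "list_all2 (\<lambda>g y. eval_recf g [string_code p] y) [Mu rt, Proj 0] ys"
      "eval_recf ro ys (string_code x)" by (auto elim: eval_recf_CompE)
    from ys(1) obtain s c where sc: "ys = [s, c]" "eval_recf (Mu rt) [string_code p] s"
      "eval_recf (Proj 0) [string_code p] c" by (auto simp: list_all2_Cons1)
    have c: "c = string_code p" using sc(3) by (auto elim: eval_recf_ProjE)
    have s: "G p s \<noteq> None" "s = (LEAST s. G p s \<noteq> None)" using search sc(2) by auto
    have "string_code x = out s (string_code p)"
      using eval_recf_deterministic[OF ys(2)[unfolded sc(1) c] ro] .
    then have "G p s = Some x"
      using s bij_is_inj[OF bij_string_code] by (auto simp: out_def dec inj_eq)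
    then show "?C p = Some x" using s by auto
  qed
  then show ?thesis unfolding partial_recursive_def by blast
qed

text \<open>Raising the step bound enumerates the domain. The values of \<open>C\<close> are
  dropped, since the oracle consists of the domain.\<close>

lemma partial_recursive_stages:
  assumes "partial_recursive C"
  shows "\<exists>E :: nat \<Rightarrow> bool list \<Rightarrow> bool. computable (\<lambda>z. E (fst z) (snd z)) \<and>
    (\<forall>t t' p. E t p \<longrightarrow> t \<le> t' \<longrightarrow> E t' p) \<and> (\<forall>p. p \<in> dom C \<longleftrightarrow> (\<exists>t. E t p))"
proof -
  obtain f where f: "\<And>p s. C p = Some s \<longleftrightarrow> eval_recf f [string_code p] (string_code s)"
    using assms unfolding partial_recursive_def by blast
  define E where "E t p \<longleftrightarrow> eval_within f t [string_code p] \<noteq> None" for t p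
  have 1: "computable (\<lambda>z. E (fst z) (snd z))"
    unfolding E_def by (intro computable_intros computable_compose2[OF computable_eval_within])
  have 2: "E t p \<Longrightarrow> t \<le> t' \<Longrightarrow> E t' p" for t t' p
    unfolding E_def using eval_within_mono by blast
  have 3: "p \<in> dom C \<longleftrightarrow> (\<exists>t. E t p)" for p
  proof -
    \<comment> \<open>Surjectivity of \<open>string_code\<close> turns any numerical value of the
      term into the code of a string.\<close>
    have "p \<in> dom C \<longleftrightarrow> (\<exists>y. eval_recf f [string_code p] y)"
      using f bij_is_surj[OF bij_string_code] unfolding dom_def by (auto) (metis surjD)
    also have "\<dots> \<longleftrightarrow> (\<exists>t. E t p)"
      unfolding E_def using eval_within_sound eval_within_complete by blast
    finally show ?thesis .
  qed
  from 1 2 3 show ?thesis by blast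
qed

section \<open>Simulation of oracle machines\<close>

instantiation symbol :: encodable
begin
primrec enc_symbol :: "symbol \<Rightarrow> nat" where
  "enc_symbol Blank = 0"
| "enc_symbol (Bit b) = Suc (of_bool b)"
| "enc_symbol (Aux k) = Suc (Suc (Suc k))"
instance
proof
  fix x y :: symbol
  show "enc x = enc y \<longleftrightarrow> x = y" by (cases x; cases y) auto
qed
end

instantiation direction :: encodable
begin
primrec enc_direction :: "direction \<Rightarrow> nat" where
  "enc_direction Move_Left = 0"
| "enc_direction Stay = 1"
| "enc_direction Move_Right = 2"
instance
proof
  fix x y :: direction
  show "enc x = enc y \<longleftrightarrow> x = y" by (cases x; cases y) auto
qed
end

primrec tape_left :: "tape \<Rightarrow> symbol list" where "tape_left (Tape ls rs) = ls"
primrec tape_right :: "tape \<Rightarrow> symbol list" where "tape_right (Tape ls rs) = rs"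

instantiation tape :: encodable
begin
definition enc_tape :: "tape \<Rightarrow> nat" where [simp]: "enc_tape t = enc (tape_left t, tape_right t)"
instance
proof
  fix x y :: tape
  show "enc x = enc y \<longleftrightarrow> x = y" by (cases x; cases y) auto
qed
end

section \<open>Computable operations on tapes\<close>

lemma computable_Bit [computable_intros]:
  assumes "computable f"
  shows "computable (\<lambda>x. Bit (f x))"
  by (rule computable_compose[OF _ assms], rule computableI[where r = "\<lambda>n. Suc n"])
    (intro rec_total_intros, simp)

lemma computable_Tape [computable_intros]:
  assumes "computable f" "computable g"
  shows "computable (\<lambda>x. Tape (f x) (g x))"
  by (rule computable_compose2[OF _ assms], rule computableI[where r = "\<lambda>n. n"])
    (intro rec_total_intros, simp)

lemma computable_tape_left [computable_intros]:
  assumes "computable f"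
  shows "computable (\<lambda>x. tape_left (f x))"
  by (rule computable_compose[OF _ assms], rule computableI[where r = "\<lambda>n. fst (prod_decode n)"])
    (intro rec_total_intros, simp)

lemma computable_tape_right [computable_intros]:
  assumes "computable f"
  shows "computable (\<lambda>x. tape_right (f x))"
  by (rule computable_compose[OF _ assms], rule computableI[where r = "\<lambda>n. snd (prod_decode n)"])
    (intro rec_total_intros, simp)

lemma computable_cell [computable_intros]:
  assumes "computable f"
  shows "computable (\<lambda>x. cell (f x))"
proof -
  have "computable (\<lambda>x. case f x of [] \<Rightarrow> Blank | a # as \<Rightarrow> a)"
    by (intro computable_intros assms)
  moreover have "(case as of [] \<Rightarrow> Blank | a # as \<Rightarrow> a) = cell as" for as by (cases as) auto
  ultimately show ?thesis by simp
qed

lemma tape_read_eq: "tape_read t = cell (tape_right t)"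
  by (cases t) simp

lemma tape_write_eq: "tape_write a t = Tape (tape_left t) (a # tl (tape_right t))"
  by (cases t) simp

lemma tape_move_eq:
  "tape_move d t =
    (if d = Move_Left then Tape (tl (tape_left t)) (cell (tape_left t) # tape_right t)
     else if d = Stay then t
     else Tape (cell (tape_right t) # tape_left t) (tl (tape_right t)))"
  by (cases d; cases t) auto

lemma bit_prefix_eq:
  "bit_prefix xs = map (\<lambda>x. x = Bit True) (takeWhile (\<lambda>x. x = Bit True \<or> x = Bit False) xs)"
  by (induction xs rule: bit_prefix.induct) auto

lemma tape_string_eq: "tape_string t = bit_prefix (tape_right t)"
  by (cases t) simp

lemma computable_tape_string [computable_intros]:
  assumes "computable f"
  shows "computable (\<lambda>x. tape_string (f x))"
  unfolding tape_string_eq bit_prefix_eq by (intro computable_intros assms)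

definition tape_over :: "symbol set \<Rightarrow> tape \<Rightarrow> bool" where
  "tape_over S t \<longleftrightarrow> set (tape_left t) \<subseteq> S \<and> set (tape_right t) \<subseteq> S"

lemma cell_in: "Blank \<in> S \<Longrightarrow> set xs \<subseteq> S \<Longrightarrow> cell xs \<in> S"
  by (cases xs) auto

lemma tape_over_write: "tape_over S t \<Longrightarrow> a \<in> S \<Longrightarrow> tape_over S (tape_write a t)"
  by (auto simp: tape_over_def tape_write_eq dest: list.set_sel(2) split: if_splits)
    (metis list.sel(2) list.set_sel(2) subsetD)

lemma tape_over_move: "tape_over S t \<Longrightarrow> Blank \<in> S \<Longrightarrow> tape_over S (tape_move d t)"
  unfolding tape_over_def tape_move_eq
  by (cases "tape_left t"; cases "tape_right t") (auto simp: subset_iff)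

text \<open>Outside the finite sets of states and symbols \<open>transition M\<close> is
  unconstrained and may fail to be computable, so a fixed default replaces it there.\<close>

definition finite_transition ::
    "oracle_machine \<Rightarrow> nat \<times> symbol \<times> symbol \<Rightarrow> nat \<times> (symbol \<times> direction) \<times> (symbol \<times> direction)" where
  "finite_transition M z =
    (if z \<in> states M \<times> alphabet M \<times> alphabet M
     then transition M (fst z) (fst (snd z)) (snd (snd z)) else (0, (Blank, Stay), (Blank, Stay)))"

definition finite_step :: "oracle_machine \<Rightarrow> (bool list \<Rightarrow> bool) \<Rightarrow> config \<Rightarrow> config" where
  "finite_step M A c =
    (if fst c = halt_state M then c
     else if fst c = query_state M then
       (if A (tape_string (snd (snd c))) then yes_state M else no_state M, snd c)
     else case finite_transition M (fst c, tape_read (fst (snd c)), tape_read (snd (snd c))) of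
       (q, z) \<Rightarrow> (q, tape_move (snd (fst z)) (tape_write (fst (fst z)) (fst (snd c))),
                  tape_move (snd (snd z)) (tape_write (fst (snd z)) (snd (snd c)))))"

lemma machine_config_Suc:
  "machine_config M A n (Suc t) = machine_step M A (machine_config M A n t)"
  by (simp add: machine_config_def)

text \<open>Ensures that a run never meets the default entry of the finite table.\<close>

lemma machine_config_invariant:
  assumes M: "oracle_turing_machine M"
  shows "fst (machine_config M A n t) \<in> states M \<and>
    tape_over (alphabet M) (fst (snd (machine_config M A n t))) \<and>
    tape_over (alphabet M) (snd (snd (machine_config M A n t)))"
proof (induction t)
  case 0
  have "x \<in> alphabet M" if "x \<in> range Bit" for x
    using M that by (auto simp: oracle_turing_machine_def) (metis (full_types))
  then show ?case
    using M by (auto simp: machine_config_def initial_config_def tape_over_def oracle_turing_machine_def)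
next
  case (Suc t)
  obtain q w v where c: "machine_config M A n t = (q, w, v)" by (metis prod_cases3)
  obtain q' a d b e where tr: "transition M q (tape_read w) (tape_read v) = (q', (a, d), (b, e))"
    by (metis surj_pair)
  have Blank: "Blank \<in> alphabet M" and wf: "\<forall>q\<in>states M. \<forall>a\<in>alphabet M. \<forall>b\<in>alphabet M.
      transition M q a b \<in> states M \<times> (alphabet M \<times> UNIV) \<times> (alphabet M \<times> UNIV)"
    and st: "yes_state M \<in> states M" "no_state M \<in> states M"
    using M by (auto simp: oracle_turing_machine_def)
  have inv: "q \<in> states M" "tape_over (alphabet M) w" "tape_over (alphabet M) v"
    using Suc c by auto
  have "tape_read w \<in> alphabet M" "tape_read v \<in> alphabet M"
    using inv Blank by (auto simp: tape_read_eq tape_over_def intro!: cell_in)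
  then have "transition M q (tape_read w) (tape_read v)
      \<in> states M \<times> (alphabet M \<times> UNIV) \<times> (alphabet M \<times> UNIV)"
    using wf inv(1) by blast
  then have "q' \<in> states M" "a \<in> alphabet M" "b \<in> alphabet M" using tr by auto
  then show ?case
    using inv Blank st tr by (auto simp: machine_config_Suc c machine_step_def tape_over_move tape_over_write)
qed

lemma machine_config_eq_finite_step:
  assumes M: "oracle_turing_machine M"
  shows "machine_config M A n t = rec_nat (initial_config M n) (\<lambda>_ c. finite_step M (\<lambda>p. p \<in> A) c) t"
proof (induction t)
  case 0
  then show ?case by (simp add: machine_config_def)
next
  case (Suc t)
  obtain q w v where c: "machine_config M A n t = (q, w, v)" by (metis prod_cases3)
  have inv: "q \<in> states M" "tape_over (alphabet M) w" "tape_over (alphabet M) v"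
    using machine_config_invariant[OF M, of A n t] c by auto
  moreover have "Blank \<in> alphabet M" using M by (auto simp: oracle_turing_machine_def)
  ultimately have "(q, tape_read w, tape_read v) \<in> states M \<times> alphabet M \<times> alphabet M"
    by (auto simp: tape_read_eq tape_over_def intro!: cell_in)
  then have "machine_step M A (q, w, v) = finite_step M (\<lambda>p. p \<in> A) (q, w, v)"
    by (auto simp: machine_step_def finite_step_def finite_transition_def split: prod.splits)
  then show ?case using Suc by (simp add: machine_config_Suc c)
qed

definition output_within :: "oracle_machine \<Rightarrow> bool list set \<Rightarrow> nat \<Rightarrow> nat \<Rightarrow> bool list option" where
  "output_within M A n t =
    (if fst (machine_config M A n t) = halt_state M
     then Some (tape_string (fst (snd (machine_config M A n t)))) else None)"

text \<open>A halting configuration is a fixed point of \<open>machine_step\<close>; hence an output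
  persists and does not depend on the time of inspection.\<close>

lemma machine_config_halted:
  assumes "fst (machine_config M A n t) = halt_state M" "t \<le> t'"
  shows "machine_config M A n t' = machine_config M A n t"
  using assms(2)
proof (induction t' rule: dec_induct)
  case (step m)
  then show ?case using assms(1)
    by (cases "machine_config M A n t") (auto simp: machine_config_Suc machine_step_def)
qed simp

lemma output_within_mono:
  assumes "output_within M A n t = Some x" "t \<le> t'"
  shows "output_within M A n t' = Some x"
  using assms machine_config_halted[OF _ assms(2)]
  by (auto simp: output_within_def split: if_splits)

lemma output_within_unique:
  "output_within M A n t = Some x \<Longrightarrow> output_within M A n t' = Some y \<Longrightarrow> x = y"
  using output_within_mono[of M A n t x "max t t'"] output_within_mono[of M A n t' y "max t t'"]
  by simp

lemma machine_output_SomeD: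
  assumes "machine_output M A n = Some x"
  shows "\<exists>t. output_within M A n t = Some x"
proof -
  have "\<exists>t. fst (machine_config M A n t) = halt_state M"
    using assms by (auto simp: machine_output_def split: if_splits)
  then have "fst (machine_config M A n (LEAST t. fst (machine_config M A n t) = halt_state M)) = halt_state M"
    by (rule LeastI_ex)
  then show ?thesis using assms
    by (auto simp: machine_output_def output_within_def split: if_splits)
qed

text \<open>The oracle enters as a decidable predicate that may depend on the input
  \<open>x\<close>, so that it can vary with the stage of an enumeration.\<close>

lemma computable_output_within:
  assumes M: "oracle_turing_machine M"
    and A: "computable (\<lambda>z. p_in (fst z) (snd z))"
    and n: "computable n" and t: "computable t"
  shows "computable (\<lambda>x. output_within M {p. p_in x p} (n x) (t x))"
proof -
  have "finite (states M \<times> alphabet M \<times> alphabet M)"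
    using M by (auto simp: oracle_turing_machine_def)
  then have "computable (finite_transition M)"
    unfolding finite_transition_def by (rule computable_finite_support)
  note c = computable_compose[OF this] computable_compose2[OF A] computable_compose[OF n] computable_compose[OF t]
  show ?thesis
    unfolding output_within_def machine_config_eq_finite_step[OF M] finite_step_def mem_Collect_eq
      tape_move_eq tape_read_eq tape_write_eq initial_config_def
    by (intro computable_intros c n t)
qed

section \<open>Prefix-free codes\<close>

lemma card_length_eq: "card {x :: bool list. length x = n} = 2 ^ n"
  using card_lists_length_eq[of "UNIV :: bool set" n] by simp

lemma finite_length_eq [simp]: "finite {x :: bool list. length x = n}"
  by (rule card_ge_0_finite) (simp add: card_length_eq)

lemma of_nat_two_power_diff: "l \<le> n \<Longrightarrow> real (2 ^ (n - l)) = 2 ^ n / 2 ^ l"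
  unfolding of_nat_power of_nat_numeral by (simp add: power_diff)

lemma card_extensions:
  assumes "length x \<le> n"
  shows "card {y :: bool list. length y = n \<and> prefix x y} = 2 ^ (n - length x)"
proof -
  have "{y. length y = n \<and> prefix x y} = (@) x ` {z. length z = n - length x}"
    using assms by (auto simp: prefix_def)
  then show ?thesis by (simp add: card_image inj_on_def card_length_eq)
qed

text \<open>Distinct members of a prefix-free set have disjoint sets of extensions of length
  \<open>n\<close>. With all strings of length \<open>n\<close> as \<open>T\<close> this is Kraft's
  inequality; later \<open>T\<close> consists of the strings with many hits.\<close>

lemma prefix_free_sum_extensions:
  assumes "prefix_free F" "finite F" "finite T"
    and "\<And>x. x \<in> F \<Longrightarrow> length x \<le> n"
    and "\<And>x y. x \<in> F \<Longrightarrow> length y = n \<Longrightarrow> prefix x y \<Longrightarrow> y \<in> T"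
  shows "(\<Sum>x\<in>F. 2 ^ (n - length x)) \<le> card T"
proof -
  let ?ext = "\<lambda>x :: bool list. {y. length y = n \<and> prefix x y}"
  have fin: "finite (?ext x)" for x
    by (rule finite_subset[OF _ finite_length_eq[of n]]) auto
  have "(\<Sum>x\<in>F. 2 ^ (n - length x)) = (\<Sum>x\<in>F. card (?ext x))"
    using assms(4) by (simp add: card_extensions)
  also have "\<dots> = card (\<Union>x\<in>F. ?ext x)"
  proof (rule card_UN_disjoint[symmetric])
    show "\<forall>x\<in>F. \<forall>y\<in>F. x \<noteq> y \<longrightarrow> ?ext x \<inter> ?ext y = {}"
      using assms(1) unfolding prefix_free_def by (metis (no_types, lifting) disjoint_iff mem_Collect_eq prefix_same_cases)
  qed (use assms(2) fin in auto)
  also have "\<dots> \<le> card T"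
    using assms(3,5) by (intro card_mono) auto
  finally show ?thesis .
qed

lemma kraft_inequality:
  assumes "prefix_free F" "finite F"
  shows "(\<Sum>x\<in>F. 1 / 2 ^ length x :: real) \<le> 1"
proof -
  define n where "n = Max (insert 0 (length ` F))"
  have n: "length x \<le> n" if "x \<in> F" for x using that assms(2) by (auto simp: n_def intro!: Max_ge)
  have "(\<Sum>x\<in>F. 2 ^ (n - length x)) \<le> card {y :: bool list. length y = n}"
    by (rule prefix_free_sum_extensions[OF assms]) (auto intro: n)
  then have "real (\<Sum>x\<in>F. 2 ^ (n - length x)) \<le> 2 ^ n"
    unfolding card_length_eq by (metis of_nat_le_iff of_nat_numeral of_nat_power)
  moreover have "real (2 ^ (n - length x)) = 1 / 2 ^ length x * 2 ^ n" if "x \<in> F" for x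
    using of_nat_two_power_diff[OF n[OF that]] by simp
  then have "real (\<Sum>x\<in>F. 2 ^ (n - length x)) = (\<Sum>x\<in>F. 1 / 2 ^ length x) * 2 ^ n"
    unfolding of_nat_sum sum_distrib_right by (intro sum.cong refl)
  ultimately show ?thesis by simp
qed

text \<open>\<open>p\<close> stands for the dyadic interval from
  \<open>bits_value p / 2 ^ length p\<close> to
  \<open>(bits_value p + 1) / 2 ^ length p\<close>.\<close>

definition bits_value :: "bool list \<Rightarrow> nat" where
  "bits_value p = foldl (\<lambda>m b. 2 * m + of_bool b) 0 p"

lemma bits_value_simps [simp]:
  "bits_value [] = 0"
  "bits_value (p @ [b]) = 2 * bits_value p + of_bool b"
  by (simp_all add: bits_value_def)

lemma computable_bits_value [computable_intros]:
  assumes "computable f"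
  shows "computable (\<lambda>x. bits_value (f x))"
proof -
  have "computable (\<lambda>x. foldl (\<lambda>m b. 2 * m + (if b then 1 else 0)) (0 :: nat) (f x))"
    by (intro computable_intros assms)
  then show ?thesis by (simp add: bits_value_def of_bool_def)
qed

lemma bits_value_append: "bits_value (p @ q) = bits_value p * 2 ^ length q + bits_value q"
  by (induction q rule: rev_induct) (auto simp flip: append_assoc simp: algebra_simps)

lemma bits_value_less: "bits_value p < 2 ^ length p"
  by (induction p rule: rev_induct) (auto simp: of_bool_def)

lemma bits_value_surj: "v < 2 ^ n \<Longrightarrow> \<exists>p. length p = n \<and> bits_value p = v"
proof (induction n arbitrary: v)
  case (Suc n)
  then have "v div 2 < 2 ^ n" by auto
  then obtain p where "length p = n" "bits_value p = v div 2" using Suc.IH by blast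
  then have "length (p @ [odd v]) = Suc n \<and> bits_value (p @ [odd v]) = v"
    by (auto simp: of_bool_def)
  then show ?case by blast
qed simp

text \<open>Appending bits selects a subinterval; consequently strings with disjoint dyadic
  intervals are incomparable.\<close>

lemma prefix_interval_subset:
  assumes "prefix p q"
  shows "real (bits_value p) / 2 ^ length p \<le> bits_value q / 2 ^ length q"
    "(real (bits_value q) + 1) / 2 ^ length q \<le> (real (bits_value p) + 1) / 2 ^ length p"
proof -
  obtain r where q: "q = p @ r" using assms by (auto simp: prefix_def)
  have "real (bits_value r) + 1 \<le> 2 ^ length r"
    using bits_value_less[of r] by (metis Suc_eq_plus1 Suc_leI of_nat_1 of_nat_add of_nat_le_iff of_nat_numeral of_nat_power)
  then have "(real (bits_value r) + 1) / 2 ^ length r / 2 ^ length p \<le> 1 / 2 ^ length p"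
    by (intro divide_right_mono) simp_all
  then show "(real (bits_value q) + 1) / 2 ^ length q \<le> (real (bits_value p) + 1) / 2 ^ length p"
    by (simp add: q bits_value_append power_add add_divide_distrib mult.commute)
  show "real (bits_value p) / 2 ^ length p \<le> bits_value q / 2 ^ length q"
    by (simp add: q bits_value_append power_add field_simps)
qed

text \<open>\<open>xs ! i\<close> has no specified value out of range, so it cannot be tracked; the
  explicit default makes the lookup total.\<close>

definition nth_or :: "'a \<Rightarrow> 'a list \<Rightarrow> nat \<Rightarrow> 'a" where
  "nth_or d xs i = (case drop i xs of [] \<Rightarrow> d | y # ys \<Rightarrow> y)"

lemma nth_or_eq [simp]: "i < length xs \<Longrightarrow> nth_or d xs i = xs ! i"
  by (simp add: nth_or_def flip: Cons_nth_drop_Suc)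

lemma computable_nth_or [computable_intros]:
  assumes "computable d" "computable f" "computable g"
  shows "computable (\<lambda>x. nth_or (d x) (f x) (g x))"
  unfolding nth_or_def by (intro computable_intros assms)

section \<open>The Kraft--Chaitin theorem\<close>

text \<open>
  Shannon--Fano--Elias coding: the requests receive consecutive intervals of length \<open>1 / 2 ^ l\<close>,
  and an interval of that length contains a dyadic interval of half its length, whose
  address serves as the code word.
\<close>

definition start :: "(nat \<times> bool list) list \<Rightarrow> nat \<Rightarrow> real" where
  "start rs i = sum_list (map (\<lambda>r. 1 / 2 ^ fst r) (take i rs))"

definition codes :: "(nat \<times> bool list) list \<Rightarrow> nat \<Rightarrow> bool list \<Rightarrow> bool" where
  "codes rs i p \<longleftrightarrow> i < length rs \<and> length p = Suc (fst (rs ! i)) \<and>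
    start rs i \<le> bits_value p / 2 ^ length p \<and>
    (real (bits_value p) + 1) / 2 ^ length p \<le> start rs i + 1 / 2 ^ fst (rs ! i)"

lemma codesD: "codes rs i p \<Longrightarrow> i < length rs" "codes rs i p \<Longrightarrow> length p = Suc (fst (rs ! i))"
  by (auto simp: codes_def)

lemma start_Suc: "i < length rs \<Longrightarrow> start rs (Suc i) = start rs i + 1 / 2 ^ fst (rs ! i)"
  by (simp add: start_def take_Suc_conv_app_nth)

lemma start_nonneg: "0 \<le> start rs i"
  unfolding start_def by (intro sum_list_nonneg) auto

lemma start_mono: "i \<le> j \<Longrightarrow> start rs i \<le> start rs j"
proof (induction j rule: dec_induct)
  case (step j)
  have "start rs j \<le> start rs (Suc j)"
    by (cases "j < length rs") (simp_all add: start_Suc, simp add: start_def)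
  then show ?case using step by simp
qed simp

text \<open>An interval depends only on the requests up to its own, so a code word once assigned
  stays valid as the list grows.\<close>

lemma codes_append:
  assumes "codes rs i p"
  shows "codes (rs @ rs') i p"
  using assms by (auto simp: codes_def start_def nth_append)

lemma codes_prefix:
  assumes "codes rs i p" "prefix rs rs'"
  shows "codes rs' i p"
  using assms codes_append by (auto simp: prefix_def)

text \<open>The prefix relation nests dyadic intervals, whereas distinct requests own disjoint
  intervals up to endpoints. Code words of one request have equal length, so a prefix among them is
  an equality.\<close>

lemma codes_disjoint:
  assumes "codes rs i p" "codes rs j q" "prefix p q"
  shows "i = j \<and> p = q"
proof -
  have *: False if "codes rs i p" "codes rs j q" "i < j"
    "x < (real (bits_value p) + 1) / 2 ^ length p" "bits_value q / 2 ^ length q \<le> x" for i j p q x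
  proof -
    have "(real (bits_value p) + 1) / 2 ^ length p \<le> start rs (Suc i)" "start rs j \<le> bits_value q / 2 ^ length q"
      using that(1,2) by (auto simp: codes_def start_Suc)
    then show False using that(3-5) start_mono[of "Suc i" j rs] by linarith
  qed
  have **: "bits_value q / 2 ^ length q < (real (bits_value q) + 1) / 2 ^ length q"
    by (simp add: field_simps)
  \<comment> \<open>The left endpoint of the interval of \<open>q\<close> lies in both dyadic
    intervals; it refutes \<open>i < j\<close> as well as \<open>j < i\<close>.\<close>
  have x: "bits_value q / 2 ^ length q < (real (bits_value p) + 1) / 2 ^ length p"
    using ** prefix_interval_subset(2)[OF assms(3)] by (rule less_le_trans)
  have "i = j"
  proof (rule linorder_cases[of i j])
    assume "i < j"
    then show ?thesis using *[OF assms(1,2) _ x] by simp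
  next
    assume "j < i"
    then show ?thesis
      using *[OF assms(2,1) _ ** prefix_interval_subset(1)[OF assms(3)]] by simp
  qed
  moreover have "p = q" if "length p = length q" using assms(3) that by (auto simp: prefix_def)
  ultimately show ?thesis using assms(1,2) by (simp add: codes_def)
qed

lemma codes_exists:
  assumes "i < length rs" "start rs (length rs) \<le> 1"
  shows "\<exists>p. codes rs i p"
proof -
  define l where "l = fst (rs ! i)"
  \<comment> \<open>In units of \<open>1 / 2 ^ Suc l\<close> the reserved interval has length 2.
    Rounding its start up costs less than one unit, so a whole unit still fits.\<close>
  define v where "v = nat \<lceil>start rs i * 2 ^ Suc l\<rceil>"
  have "start rs (Suc i) \<le> 1" using start_mono[of "Suc i" "length rs" rs] assms by simp
  then have le: "start rs i + 1 / 2 ^ l \<le> 1" using assms(1) by (simp add: start_Suc l_def)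
  have v: "start rs i * 2 ^ Suc l \<le> v" "v < start rs i * 2 ^ Suc l + 1"
    using start_nonneg[of rs i] unfolding v_def by (auto simp: ceiling_less_iff) linarith+
  have "start rs i * 2 ^ Suc l + 2 = (start rs i + 1 / 2 ^ l) * 2 ^ Suc l"
    by (simp add: distrib_right)
  also have "\<dots> \<le> 1 * 2 ^ Suc l" using le by (rule mult_right_mono) simp
  finally have v': "real v + 1 \<le> start rs i * 2 ^ Suc l + 2" "real v < 2 ^ Suc l" using v by linarith+
  then have "v < 2 ^ Suc l" by (metis of_nat_less_iff of_nat_numeral of_nat_power)
  then obtain p where p: "length p = Suc l" "bits_value p = v" using bits_value_surj by blast
  have "start rs i \<le> real v / 2 ^ Suc l"
    using v(1) by (simp only: pos_le_divide_eq zero_less_power zero_less_numeral)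
  moreover have "(real v + 1) / 2 ^ Suc l \<le> start rs i + 1 / 2 ^ l"
    using v'(1) by (simp add: pos_divide_le_eq distrib_right)
  ultimately have "codes rs i p"
    using assms(1) by (simp add: codes_def p l_def[symmetric] add.commute)
  then show ?thesis by blast
qed

text \<open>A power \<open>2 ^ scale rs\<close> clears all denominators, which turns the real
  inequalities of \<open>codes\<close> into decidable ones between natural numbers. The
  \<open>Suc\<close> makes room for code words, which are one bit longer than requested.\<close>

definition scale :: "(nat \<times> bool list) list \<Rightarrow> nat" where
  "scale rs = Suc (sum_list (map fst rs))"

lemma less_scale: "r \<in> set rs \<Longrightarrow> fst r < scale rs"
  using member_le_sum_list[of "fst r" "map fst rs"] by (auto simp: scale_def)

definition scaled_start :: "(nat \<times> bool list) list \<Rightarrow> nat \<Rightarrow> nat" where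
  "scaled_start rs i = sum_list (map (\<lambda>r. 2 ^ (scale rs - fst r)) (take i rs))"

lemma scaled_start_eq: "real (scaled_start rs i) = start rs i * 2 ^ scale rs"
proof -
  have "real (sum_list (map (\<lambda>r. 2 ^ (L - fst r)) qs)) = sum_list (map (\<lambda>r. 1 / 2 ^ fst r) qs) * 2 ^ L"
    if "\<And>r. r \<in> set qs \<Longrightarrow> fst r < L" for qs :: "(nat \<times> bool list) list" and L
    using that
  proof (induction qs)
    case (Cons q qs)
    then show ?case
      using of_nat_two_power_diff[of "fst q" L] by (simp add: less_imp_le algebra_simps)
  qed simp
  then show ?thesis
    unfolding scaled_start_def start_def by (meson in_set_takeD less_scale)
qed

lemma codes_scaled:
  "codes rs i p \<longleftrightarrow> i < length rs \<and> length p = Suc (fst (nth_or (0, []) rs i)) \<and>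
    scaled_start rs i \<le> bits_value p * 2 ^ (scale rs - length p) \<and>
    Suc (bits_value p) * 2 ^ (scale rs - length p) \<le> scaled_start rs i + 2 ^ (scale rs - fst (nth_or (0, []) rs i))"
proof (cases "i < length rs \<and> length p = Suc (fst (rs ! i))")
  case True
  define L where "L = scale rs"
  have l: "fst (rs ! i) < L" using True less_scale[of "rs ! i" rs] by (simp add: L_def)
  then have p: "length p \<le> L" using True by simp
  have "scaled_start rs i \<le> bits_value p * 2 ^ (L - length p) \<longleftrightarrow>
      real (scaled_start rs i) \<le> real (bits_value p * 2 ^ (L - length p))"
    by (simp only: of_nat_le_iff)
  also have "\<dots> \<longleftrightarrow> start rs i * 2 ^ L \<le> bits_value p / 2 ^ length p * 2 ^ L"
    unfolding of_nat_mult of_nat_two_power_diff[OF p] by (simp add: scaled_start_eq L_def)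
  also have "\<dots> \<longleftrightarrow> start rs i \<le> bits_value p / 2 ^ length p"
    by (rule mult_le_cancel_right_pos) simp
  finally have 1: "scaled_start rs i \<le> bits_value p * 2 ^ (L - length p) \<longleftrightarrow>
    start rs i \<le> bits_value p / 2 ^ length p" .
  have "Suc (bits_value p) * 2 ^ (L - length p) \<le> scaled_start rs i + 2 ^ (L - fst (rs ! i)) \<longleftrightarrow>
      real (Suc (bits_value p) * 2 ^ (L - length p)) \<le> real (scaled_start rs i + 2 ^ (L - fst (rs ! i)))"
    by (simp only: of_nat_le_iff)
  also have "\<dots> \<longleftrightarrow> (real (bits_value p) + 1) / 2 ^ length p * 2 ^ L \<le> (start rs i + 1 / 2 ^ fst (rs ! i)) * 2 ^ L"
    unfolding of_nat_mult of_nat_add of_nat_two_power_diff[OF p] of_nat_two_power_diff[OF less_imp_le[OF l]]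
      scaled_start_eq L_def[symmetric] by (simp add: add.commute distrib_right)
  also have "\<dots> \<longleftrightarrow> (real (bits_value p) + 1) / 2 ^ length p \<le> start rs i + 1 / 2 ^ fst (rs ! i)"
    by (rule mult_le_cancel_right_pos) simp
  finally show ?thesis
    using True 1 by (simp add: codes_def L_def)
qed (auto simp: codes_def)

lemma computable_codes [computable_intros]:
  assumes "computable f" "computable i" "computable p"
  shows "computable (\<lambda>x. codes (f x) (i x) (p x))"
  unfolding codes_scaled scaled_start_def scale_def
  by (intro computable_intros assms computable_compose[OF assms(1)])

text \<open>A stage at which \<open>p\<close> codes some request settles the value of
  \<open>p\<close>, since assignments survive later requests. The additional bit is the price of the
  half interval. An interval may contain two code words; both belong to the domain and, having equal
  length, are incomparable.\<close>

theorem kraft_chaitin: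
  fixes R :: "nat \<Rightarrow> (nat \<times> bool list) list"
  assumes R: "computable R"
    and chain: "\<And>s. prefix (R s) (R (Suc s))"
    and weight: "\<And>s. sum_list (map (\<lambda>r. 1 / 2 ^ fst r :: real) (R s)) \<le> 1"
  shows "\<exists>C. computer C \<and> (\<forall>s. \<forall>r\<in>set (R s). \<exists>p. C p = Some (snd r) \<and> length p = Suc (fst r))"
proof -
  define G where "G p s = (case filter (\<lambda>i. codes (R s) i p) [0..<length (R s)] of
      [] \<Rightarrow> None | i # is \<Rightarrow> Some (snd (nth_or (0, []) (R s) i)))" for p s
  define C where "C p = (if \<exists>s. G p s \<noteq> None then G p (LEAST s. G p s \<noteq> None) else None)" for p
  have "computable (\<lambda>z. G (fst z) (snd z))"
    unfolding G_def by (intro computable_intros computable_compose[OF R])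
  then have rec: "partial_recursive C"
    unfolding C_def by (rule partial_recursive_search)
  have mono: "prefix (R s) (R s')" if "s \<le> s'" for s s'
    using that by (induction s' rule: dec_induct) (auto intro: prefix_order.trans[OF _ chain])
  have nth: "codes (R s) i p \<Longrightarrow> s \<le> s' \<Longrightarrow> R s ! i = R s' ! i" for s s' i p
    using mono[of s s'] by (auto simp: codes_def prefix_def nth_append)
  have G: "\<exists>i. codes (R s) i p \<and> x = snd (R s ! i)" if "G p s = Some x" for p s x
  proof -
    let ?F = "filter (\<lambda>i. codes (R s) i p) [0..<length (R s)]"
    have "?F \<noteq> []" using that by (metis G_def list.simps(4) option.distinct(1))
    then obtain i js where i: "?F = i # js" by (meson neq_Nil_conv)
    then have "i \<in> set ?F" by (metis list.set_intros(1))
    then have "codes (R s) i p" "i < length (R s)" by auto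
    moreover have "x = snd (R s ! i)" using that \<open>i < length (R s)\<close> unfolding G_def i by simp
    ultimately show ?thesis by blast
  qed
  have C_SomeD: "\<exists>s i. codes (R s) i p \<and> x = snd (R s ! i)" if "C p = Some x" for p x
  proof -
    have "G p (LEAST s. G p s \<noteq> None) = Some x" using that by (simp add: C_def split: if_splits)
    then show ?thesis using G by blast
  qed
  \<comment> \<open>Two stages are compared at the later one, whose list extends both.\<close>
  have unique: "p = q \<and> R s ! i = R s' ! j"
    if "codes (R s) i p" "codes (R s') j q" "prefix p q" for s s' i j p q
  proof -
    let ?m = "max s s'"
    have "codes (R ?m) i p" "codes (R ?m) j q"
      using that(1,2) mono by (auto intro: codes_prefix)
    then have "i = j \<and> p = q" using that(3) by (rule codes_disjoint)
    then show ?thesis using nth[OF that(1), of ?m] nth[OF that(2), of ?m] by simp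
  qed
  have C_SomeI: "C p = Some (snd (R s ! i))" if c: "codes (R s) i p" for p s i
  proof -
    let ?F = "filter (\<lambda>i. codes (R s) i p) [0..<length (R s)]"
    have "i \<in> set ?F" using c codesD(1)[OF c] by simp
    then obtain k ks where "?F = k # ks" by (metis list.set_cases)
    then have "G p s \<noteq> None" unfolding G_def by simp
    then have "G p (LEAST s. G p s \<noteq> None) \<noteq> None" "\<exists>s. G p s \<noteq> None"
      by (rule LeastI, blast)
    then have "C p \<noteq> None" unfolding C_def by (simp only: if_True not_False_eq_True)
    then obtain x where x: "C p = Some x" by blast
    \<comment> \<open>The least successful stage may differ from \<open>s\<close>;
      \<open>unique\<close> identifies the request found there.\<close>
    then obtain s' j where "codes (R s') j p" "x = snd (R s' ! j)" using C_SomeD by blast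
    then show ?thesis using x unique[OF c] by simp
  qed
  have "prefix_free (dom C)"
    unfolding prefix_free_def using C_SomeD unique by blast
  then have "computer C" using rec by (simp add: computer_def)
  moreover have "\<exists>p. C p = Some (snd r) \<and> length p = Suc (fst r)" if r: "r \<in> set (R s)" for s r
  proof -
    obtain i where i: "i < length (R s)" "r = R s ! i" using r by (auto simp: in_set_conv_nth)
    obtain p where p: "codes (R s) i p"
      using codes_exists[OF i(1)] weight[of s] by (auto simp: start_def)
    then have "length p = Suc (fst r)" by (simp add: codes_def i)
    then show ?thesis using C_SomeI[OF p] i by blast
  qed
  ultimately show ?thesis by blast
qed

section \<open>Solovay tests\<close>

text \<open>Each \<open>n\<close> counts once, however many of its outputs are prefixes of
  \<open>x\<close>. The parameter \<open>s\<close> bounds both \<open>n\<close> and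
  \<open>t\<close>, which keeps the count computable.\<close>

definition hits :: "(nat \<Rightarrow> nat \<Rightarrow> bool list option) \<Rightarrow> nat \<Rightarrow> bool list \<Rightarrow> nat" where
  "hits C s x = length (filter (\<lambda>n. list_ex (\<lambda>t. case C n t of None \<Rightarrow> False | Some y \<Rightarrow> prefix y x) [0..<s]) [0..<s])"

lemma hits_card: "hits C s x = card {n. n < s \<and> (\<exists>t<s. \<exists>y. C n t = Some y \<and> prefix y x)}"
proof -
  have "hits C s x = card (set (filter (\<lambda>n. list_ex (\<lambda>t. case C n t of None \<Rightarrow> False | Some y \<Rightarrow> prefix y x) [0..<s]) [0..<s]))"
    unfolding hits_def by (rule distinct_card[symmetric]) simp
  also have "set (filter (\<lambda>n. list_ex (\<lambda>t. case C n t of None \<Rightarrow> False | Some y \<Rightarrow> prefix y x) [0..<s]) [0..<s])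
      = {n. n < s \<and> (\<exists>t<s. \<exists>y. C n t = Some y \<and> prefix y x)}"
    by (auto simp: list_ex_iff split: option.splits)
  finally show ?thesis .
qed

lemma hits_mono:
  assumes "s \<le> s'" "prefix x x'"
  shows "hits C s x \<le> hits C s' x'"
  unfolding hits_card
proof (rule card_mono)
  show "{n. n < s \<and> (\<exists>t<s. \<exists>y. C n t = Some y \<and> prefix y x)}
      \<subseteq> {n. n < s' \<and> (\<exists>t<s'. \<exists>y. C n t = Some y \<and> prefix y x')}"
    using assms by (auto intro: prefix_order.trans) (metis order_less_le_trans prefix_order.trans)
qed simp

lemma hits_le: "hits C s x \<le> s"
proof -
  have "hits C s x \<le> card {..<s}" unfolding hits_card by (rule card_mono) auto
  then show ?thesis by simp
qed

lemma computable_hits: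
  assumes "computable (\<lambda>z. C (fst z) (snd z))" "computable f" "computable g"
  shows "computable (\<lambda>z. hits C (f z) (g z))"
  unfolding hits_def
  by (intro computable_intros computable_compose2[OF assms(1)] computable_compose[OF assms(2)]
      computable_compose[OF assms(3)] assms)

text \<open>The part of the Solovay test that is visible at stage \<open>s\<close>. Repeated outputs
  of one \<open>n\<close> are weighed once, equal outputs of different \<open>n\<close>
  separately.\<close>

definition test_weight :: "(nat \<Rightarrow> nat \<Rightarrow> bool list option) \<Rightarrow> nat \<Rightarrow> real" where
  "test_weight C s = (\<Sum>n<s. \<Sum>y\<in>{y. \<exists>t<s. C n t = Some y}. 1 / 2 ^ length y)"

lemma finite_stage_outputs:
  fixes C :: "nat \<Rightarrow> nat \<Rightarrow> bool list option"
  shows "finite {y. \<exists>t<s. C n t = Some y}"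
proof (rule finite_subset)
  show "{y. \<exists>t<s. C n t = Some y} \<subseteq> (\<lambda>t. the (C n t)) ` {..<s}" by force
qed simp

text \<open>Double counting: \<open>y\<close> is a prefix of the fraction
  \<open>1 / 2 ^ length y\<close> of all strings of length \<open>s\<close>. The fraction is exact
  because \<open>short\<close> gives \<open>length y \<le> n < s\<close>.\<close>

lemma sum_hits_le:
  assumes short: "\<And>n t y. C n t = Some y \<Longrightarrow> length y \<le> n"
  shows "real (\<Sum>x | length x = s. hits C s x) \<le> test_weight C s * 2 ^ s"
proof -
  let ?L = "{x :: bool list. length x = s}" and ?Y = "\<lambda>n. {y. \<exists>t<s. C n t = Some y}"
  have "(\<Sum>x\<in>?L. hits C s x) = (\<Sum>x\<in>?L. \<Sum>n<s. of_bool (\<exists>y\<in>?Y n. prefix y x))"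
  proof (rule sum.cong)
    fix x
    have "{n. n < s \<and> (\<exists>t<s. \<exists>y. C n t = Some y \<and> prefix y x)} = {..<s} \<inter> {n. \<exists>y\<in>?Y n. prefix y x}"
      by auto
    then show "hits C s x = (\<Sum>n<s. of_bool (\<exists>y\<in>?Y n. prefix y x))"
      by (simp add: hits_card sum_of_bool_eq)
  qed simp
  also have "\<dots> = (\<Sum>n<s. \<Sum>x\<in>?L. of_bool (\<exists>y\<in>?Y n. prefix y x))" by (rule sum.swap)
  also have "\<dots> \<le> (\<Sum>n<s. \<Sum>y\<in>?Y n. (2 :: nat) ^ (s - length y))"
  proof (rule sum_mono)
    fix n assume n: "n \<in> {..<s}"
    have "(\<Sum>x\<in>?L. of_bool (\<exists>y\<in>?Y n. prefix y x)) = card (\<Union>y\<in>?Y n. {x. length x = s \<and> prefix y x})"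
      by (subst sum_of_bool_eq) (auto intro!: arg_cong[where f = card])
    also have "\<dots> \<le> (\<Sum>y\<in>?Y n. card {x. length x = s \<and> prefix y x})"
      by (rule card_UN_le[OF finite_stage_outputs])
    also have "\<dots> = (\<Sum>y\<in>?Y n. (2 :: nat) ^ (s - length y))"
    proof (rule sum.cong)
      fix y assume "y \<in> ?Y n"
      then have "length y \<le> s" using short n by fastforce
      then show "card {x. length x = s \<and> prefix y x} = 2 ^ (s - length y)" by (rule card_extensions)
    qed simp
    finally show "(\<Sum>x\<in>?L. of_bool (\<exists>y\<in>?Y n. prefix y x)) \<le> (\<Sum>y\<in>?Y n. (2 :: nat) ^ (s - length y))" .
  qed
  finally have "real (\<Sum>x\<in>?L. hits C s x) \<le> real (\<Sum>n<s. \<Sum>y\<in>?Y n. (2 :: nat) ^ (s - length y))"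
    by (simp only: of_nat_le_iff)
  also have "\<dots> = test_weight C s * 2 ^ s"
    unfolding test_weight_def sum_distrib_right of_nat_sum
  proof (intro sum.cong refl)
    fix n y assume "n \<in> {..<s}" "y \<in> ?Y n"
    then have "length y \<le> s" using short by fastforce
    then show "real (2 ^ (s - length y)) = 1 / 2 ^ length y * 2 ^ s"
      using of_nat_two_power_diff by simp
  qed
  finally show ?thesis .
qed

text \<open>A string is inspected only at the stage that equals its length.\<close>

definition reaches :: "(nat \<Rightarrow> nat \<Rightarrow> bool list option) \<Rightarrow> nat \<Rightarrow> bool list \<Rightarrow> bool" where
  "reaches C k x \<longleftrightarrow> x \<noteq> [] \<and> 4 ^ k \<le> hits C (length x) x \<and>
    hits C (length x - 1) (take (length x - 1) x) < 4 ^ k"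

text \<open>Passing to an extension and a later stage never lowers the count, so along a branch the
  threshold is crossed at only one length.\<close>

lemma prefix_free_reaches: "prefix_free {x. reaches C k x}"
  unfolding prefix_free_def
proof (intro ballI impI)
  fix x y assume x: "x \<in> {x. reaches C k x}" and y: "y \<in> {x. reaches C k x}" and "prefix x y"
  then obtain z where z: "y = x @ z" by (auto simp: prefix_def)
  show "x = y"
  proof (rule ccontr)
    assume "x \<noteq> y"
    then have "length x \<le> length y - 1" "prefix x (take (length y - 1) y)"
      using z by (cases z rule: rev_cases; simp)+
    then have "hits C (length x) x \<le> hits C (length y - 1) (take (length y - 1) y)"
      by (rule hits_mono)
    then show False using x y by (simp add: reaches_def)
  qed
qed

text \<open>Markov's inequality: strings of length \<open>s\<close> with at least
  \<open>4 ^ k\<close> hits make up at most the fraction \<open>W / 4 ^ k\<close>, and they include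
  all extensions of the strings summed on the left.\<close>

lemma sum_reaches_le:
  assumes short: "\<And>n t y. C n t = Some y \<Longrightarrow> length y \<le> n" and W: "\<And>s. test_weight C s \<le> W"
  shows "(\<Sum>x | length x < s \<and> reaches C k x. 1 / 2 ^ length x) \<le> W / 4 ^ k"
proof -
  let ?F = "{x. length x < s \<and> reaches C k x}" and ?T = "{x. length x = s \<and> 4 ^ k \<le> hits C s x}"
  have finF: "finite ?F"
    by (rule finite_subset[of _ "\<Union>n<s. {x. length x = n}"]) auto
  have finT: "finite ?T" by (rule finite_subset[OF _ finite_length_eq[of s]]) auto
  have "(\<Sum>x\<in>?F. (2 :: nat) ^ (s - length x)) \<le> card ?T"
  proof (rule prefix_free_sum_extensions)
    show "prefix_free ?F" using prefix_free_reaches[of C k] by (auto simp: prefix_free_def)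
    fix x y :: "bool list" assume x: "x \<in> ?F" and y: "length y = s" "prefix x y"
    then have "hits C (length x) x \<le> hits C s y" by (intro hits_mono) auto
    then show "y \<in> ?T" using x y by (auto simp: reaches_def)
  qed (use finF finT in auto)
  then have "real (\<Sum>x\<in>?F. (2 :: nat) ^ (s - length x)) \<le> card ?T" by (simp only: of_nat_le_iff)
  also have "real (\<Sum>x\<in>?F. (2 :: nat) ^ (s - length x)) = (\<Sum>x\<in>?F. 1 / 2 ^ length x) * 2 ^ s"
    unfolding of_nat_sum sum_distrib_right
    by (intro sum.cong refl) (use of_nat_two_power_diff in auto)
  finally have "(\<Sum>x\<in>?F. 1 / 2 ^ length x) * 2 ^ s * 4 ^ k \<le> real (card ?T * 4 ^ k)"
    by (simp add: mult_right_mono)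
  also have "card ?T * 4 ^ k \<le> (\<Sum>x | length x = s. hits C s x)"
  proof -
    have "card ?T * 4 ^ k \<le> (\<Sum>x\<in>?T. hits C s x)"
      using sum_bounded_below[of ?T "4 ^ k" "hits C s"] by auto
    also have "\<dots> \<le> (\<Sum>x | length x = s. hits C s x)"
      by (rule sum_mono2) auto
    finally show ?thesis .
  qed
  then have "real (card ?T * 4 ^ k) \<le> real (\<Sum>x | length x = s. hits C s x)" by (simp only: of_nat_le_iff)
  also have "\<dots> \<le> test_weight C s * 2 ^ s" by (rule sum_hits_le[OF short])
  also have "\<dots> \<le> W * 2 ^ s" using W by (rule mult_right_mono) simp
  finally show ?thesis by (simp add: field_simps)
qed

text \<open>
  The strings that reach \<open>4 ^ k\<close> hits have total measure at most \<open>2 ^ w / 4 ^ k\<close>, so that codes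
  shorter than the strings by \<open>k\<close> have total weight proportional to the sum of the \<open>2 ^ k / 4 ^ k\<close>.
\<close>

definition stage_requests :: "(nat \<Rightarrow> nat \<Rightarrow> bool list option) \<Rightarrow> nat \<Rightarrow> nat \<Rightarrow> (nat \<times> bool list) list" where
  "stage_requests C w s = concat (map (\<lambda>k. map (\<lambda>x. (Suc (s + w) - k, x))
     (filter (\<lambda>x. reaches C k x) (List.n_lists s [False, True]))) [0..<Suc s])"

definition requests :: "(nat \<Rightarrow> nat \<Rightarrow> bool list option) \<Rightarrow> nat \<Rightarrow> nat \<Rightarrow> (nat \<times> bool list) list" where
  "requests C w s = concat (map (\<lambda>r. stage_requests C w r) [0..<s])"

lemma sum_list_concat_eq: "sum_list (concat xss) = sum_list (map sum_list (xss :: real list list))"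
  by (induction xss) auto

lemma computable_requests:
  assumes "computable (\<lambda>z. C (fst z) (snd z))"
  shows "computable (\<lambda>s. requests C w s)"
  unfolding requests_def stage_requests_def reaches_def
  by (intro computable_intros computable_hits[OF assms])

text \<open>Level \<open>k\<close> has measure at most \<open>2 ^ w / 4 ^ k\<close> and is charged
  with the factor \<open>2 ^ k / 2 ^ Suc w\<close>, which leaves \<open>(1 / 2) ^ Suc k\<close>. The
  \<open>Suc\<close> in the requested length compensates for the sum 2 of the series of the
  \<open>1 / 2 ^ k\<close>.\<close>

lemma requests_weight:
  assumes short: "\<And>n t y. C n t = Some y \<Longrightarrow> length y \<le> n" and W: "\<And>s. test_weight C s \<le> 2 ^ w"
  shows "sum_list (map (\<lambda>r. 1 / 2 ^ fst r :: real) (requests C w s)) \<le> 1"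
proof -
  have set_bits: "set (List.n_lists r [False, True]) = {x. length x = r}" for r
    by (auto simp: set_n_lists)
  have stage: "sum_list (map (\<lambda>r. 1 / 2 ^ fst r :: real) (stage_requests C w r))
      = (\<Sum>k\<le>r. \<Sum>x | length x = r \<and> reaches C k x. 2 ^ k / 2 ^ Suc w * (1 / 2 ^ length x))" for r
  proof -
    have "sum_list (map (\<lambda>r. 1 / 2 ^ fst r :: real) (stage_requests C w r))
      = (\<Sum>k\<leftarrow>[0..<Suc r]. \<Sum>x\<leftarrow>filter (reaches C k) (List.n_lists r [False, True]). 1 / 2 ^ (Suc (r + w) - k))"
      unfolding stage_requests_def by (simp add: map_concat sum_list_concat_eq comp_def del: upt_Suc)
    also have "\<dots> = (\<Sum>k\<in>{0..<Suc r}. \<Sum>x | length x = r \<and> reaches C k x. 1 / 2 ^ (Suc (r + w) - k))"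
      by (simp add: sum_list_distinct_conv_sum_set distinct_n_lists set_bits Int_def conj_commute del: upt_Suc)
    \<comment> \<open>\<open>k \<le> r\<close> makes the subtraction in the exponent exact.\<close>
    also have "\<dots> = (\<Sum>k\<le>r. \<Sum>x | length x = r \<and> reaches C k x. 2 ^ k / 2 ^ Suc w * (1 / 2 ^ length x))"
      by (intro sum.cong refl) (auto simp: power_diff power_add)
    finally show ?thesis .
  qed
  have "sum_list (map (\<lambda>r. 1 / 2 ^ fst r :: real) (requests C w s))
      = (\<Sum>r<s. \<Sum>k\<le>r. \<Sum>x | length x = r \<and> reaches C k x. 2 ^ k / 2 ^ Suc w * (1 / 2 ^ length x))"
    unfolding requests_def
    by (induction s) (simp_all add: stage)
  \<comment> \<open>The range of \<open>k\<close> is enlarged so as not to depend on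
    \<open>r\<close>; this permits the exchange of sums.\<close>
  also have "\<dots> \<le> (\<Sum>r<s. \<Sum>k\<le>s. \<Sum>x | length x = r \<and> reaches C k x. 2 ^ k / 2 ^ Suc w * (1 / 2 ^ length x))"
    by (intro sum_mono sum_mono2) (auto intro!: sum_nonneg)
  also have "\<dots> = (\<Sum>k\<le>s. \<Sum>r<s. \<Sum>x | length x = r \<and> reaches C k x. 2 ^ k / 2 ^ Suc w * (1 / 2 ^ length x))"
    by (rule sum.swap)
  also have "\<dots> = (\<Sum>k\<le>s. 2 ^ k / 2 ^ Suc w * (\<Sum>x | length x < s \<and> reaches C k x. 1 / 2 ^ length x))"
  proof (rule sum.cong)
    fix k
    have "(\<Sum>x | length x < s \<and> reaches C k x. 1 / 2 ^ length x :: real)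
        = (\<Sum>x\<in>(\<Union>r\<in>{..<s}. {x. length x = r \<and> reaches C k x}). 1 / 2 ^ length x)"
      by (rule sum.cong) auto
    also have "\<dots> = (\<Sum>r<s. \<Sum>x | length x = r \<and> reaches C k x. 1 / 2 ^ length x)"
      by (rule sum.UNION_disjoint) (auto intro: finite_subset[OF _ finite_length_eq])
    finally show "(\<Sum>r<s. \<Sum>x | length x = r \<and> reaches C k x. (2 :: real) ^ k / 2 ^ Suc w * (1 / 2 ^ length x))
        = 2 ^ k / 2 ^ Suc w * (\<Sum>x | length x < s \<and> reaches C k x. 1 / 2 ^ length x)"
      by (simp only: sum_distrib_left)
  qed simp
  also have "\<dots> \<le> (\<Sum>k\<le>s. 2 ^ k / 2 ^ Suc w * (2 ^ w / 4 ^ k))"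
    by (intro sum_mono mult_left_mono sum_reaches_le short W) auto
  also have "\<dots> = (\<Sum>k\<le>s. (1 / 2) ^ Suc k)"
  proof (rule sum.cong)
    fix k
    have "(4 :: real) ^ k = 2 ^ k * 2 ^ k" by (simp flip: power_mult_distrib)
    then show "2 ^ k / 2 ^ Suc w * (2 ^ w / 4 ^ k) = (1 / 2 :: real) ^ Suc k"
      by (simp add: power_divide)
  qed simp
  also have "\<dots> = 1 - (1 / 2) ^ Suc s"
    by (induction s) (simp_all add: field_simps)
  also have "\<dots> \<le> 1" by simp
  finally show ?thesis .
qed

section \<open>Compression along an infinite sequence\<close>

lemma H_le: "U q = Some x \<Longrightarrow> H U x \<le> length q"
  unfolding H_def by (rule Least_le) blast

lemma hits_unbounded:
  assumes short: "\<And>n t y. C n t = Some y \<Longrightarrow> length y \<le> n"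
    and inf: "infinite {n. \<exists>t m. C n t = Some (map \<beta> [0..<m])}"
  shows "\<exists>s. K \<le> hits C s (map \<beta> [0..<s])"
proof -
  obtain F where F: "F \<subseteq> {n. \<exists>t m. C n t = Some (map \<beta> [0..<m])}" "finite F" "card F = K"
    using infinite_arbitrarily_large[OF inf] by blast
  have "\<forall>n\<in>F. \<exists>t m. C n t = Some (map \<beta> [0..<m])" using F(1) by blast
  then obtain t m where tm: "\<And>n. n \<in> F \<Longrightarrow> C n (t n) = Some (map \<beta> [0..<m n])" by metis
  \<comment> \<open>\<open>s\<close> exceeds every chosen \<open>n\<close> and its stage
    \<open>t n\<close>, so all of them are visible to the count.\<close>
  define s where "s = Suc (Max (insert 0 (F \<union> t ` F)))"
  have s: "n < s" "t n < s" if "n \<in> F" for n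
    using F(2) that unfolding s_def less_Suc_eq_le by (auto intro!: Max_ge)
  have "prefix (map \<beta> [0..<m n]) (map \<beta> [0..<s])" if "n \<in> F" for n
  proof -
    have "m n \<le> s" using short[OF tm[OF that]] s(1)[OF that] by simp
    then have "map \<beta> [0..<s] = map \<beta> [0..<m n] @ map \<beta> [m n..<s]"
      by (metis le0 le_Suc_ex map_append upt_add_eq_append)
    then show ?thesis by (simp add: prefix_def)
  qed
  then have "F \<subseteq> {n. n < s \<and> (\<exists>t<s. \<exists>y. C n t = Some y \<and> prefix y (map \<beta> [0..<s]))}"
    using s tm by blast
  then have "K \<le> hits C s (map \<beta> [0..<s])"
    unfolding hits_card F(3)[symmetric] by (intro card_mono) auto
  then show ?thesis by blast
qed

text \<open>The string to compress is the shortest prefix whose count meets the threshold: being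
  shortest, it satisfies \<open>reaches\<close> and is requested.\<close>

theorem solovay_test_compresses:
  fixes \<beta> :: "nat \<Rightarrow> bool"
  assumes U: "optimal U" and comp: "computable (\<lambda>z. C (fst z) (snd z))"
    and short: "\<And>n t y. C n t = Some y \<Longrightarrow> length y \<le> n"
    and W: "\<And>s. test_weight C s \<le> 2 ^ w"
    and inf: "infinite {n. \<exists>t m. C n t = Some (map \<beta> [0..<m])}"
  shows "\<exists>s\<ge>1. H U (map \<beta> [0..<s]) + c < s"
proof -
  let ?x = "\<lambda>s. map \<beta> [0..<s]"
  have "prefix (requests C w s) (requests C w (Suc s))" for s
    by (simp add: requests_def)
  moreover have "sum_list (map (\<lambda>r. 1 / 2 ^ fst r :: real) (requests C w s)) \<le> 1" for s
    by (rule requests_weight[OF short W])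
  ultimately
  obtain D where D: "computer D"
    "\<forall>s. \<forall>r\<in>set (requests C w s). \<exists>p. D p = Some (snd r) \<and> length p = Suc (fst r)"
    using kraft_chaitin[OF computable_requests[OF comp, of w]] by blast
  obtain d where d: "\<forall>p\<in>dom D. \<exists>q. U q = D p \<and> length q \<le> length p + d"
    using U D(1) unfolding optimal_def by blast
  \<comment> \<open>The code word has length \<open>s + w + 2 - k\<close>, with one bit from the
    request and one from the coding; \<open>U\<close> adds at most \<open>d\<close>. A saving of
    more than \<open>c\<close> thus asks for \<open>k > w + d + c + 2\<close>.\<close>
  define k where "k = w + d + c + 3"
  define s where "s = (LEAST s. 4 ^ k \<le> hits C s (?x s))"
  have s: "4 ^ k \<le> hits C s (?x s)"
    unfolding s_def by (rule LeastI_ex) (rule hits_unbounded[OF short inf])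
  \<comment> \<open>A count at stage \<open>s\<close> is at most \<open>s\<close>, so
    \<open>k < 4 ^ k \<le> s\<close>; stage \<open>s\<close> treats only the levels
    \<open>k \<le> s\<close>.\<close>
  then have "(4::nat) ^ k \<le> s" using hits_le order.trans by blast
  then have ks: "k < s" using less_exp[of k] power_mono[of 2 "4::nat" k] by linarith
  have "hits C (s - 1) (?x (s - 1)) < 4 ^ k"
    using not_less_Least[of "s - 1" "\<lambda>s. 4 ^ k \<le> hits C s (?x s)"] ks by (simp add: s_def)
  moreover have "take (s - 1) (?x s) = ?x (s - 1)" by (simp add: take_map)
  ultimately have "reaches C k (?x s)" using s ks by (simp add: reaches_def)
  moreover have "?x s \<in> set (List.n_lists s [False, True])" by (auto simp: set_n_lists)
  ultimately have "(Suc (s + w) - k, ?x s) \<in> set (stage_requests C w s)"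
    using ks by (auto simp: stage_requests_def simp del: upt_Suc)
  then have "(Suc (s + w) - k, ?x s) \<in> set (requests C w (Suc s))" by (simp add: requests_def)
  then obtain p where p: "D p = Some (?x s)" "length p = Suc (Suc (s + w) - k)" using D(2) by force
  then obtain q where "U q = Some (?x s)" "length q \<le> length p + d" using d by (metis domI)
  then have "H U (?x s) \<le> length p + d" using H_le[of U q "?x s"] by linarith
  then have "H U (?x s) + c < s" using p(2) ks by (simp add: k_def)
  then show ?thesis using ks by (intro exI[of _ s]) simp
qed

section \<open>Outputs with an approximated oracle\<close>

text \<open>\<open>t\<close> is both the enumeration stage and the number of machine steps. An
  incomplete oracle may produce anything; the length test holds the weight of such an output to
  \<open>1 / 2 ^ (n - b)\<close>.\<close>

definition domain_oracle_test ::
    "oracle_machine \<Rightarrow> (nat \<Rightarrow> bool list \<Rightarrow> bool) \<Rightarrow> nat \<Rightarrow> nat \<Rightarrow> nat \<Rightarrow> bool list option" where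
  "domain_oracle_test M E b n t =
    (case output_within M {p. E t p \<and> length p \<le> n} n t of
      None \<Rightarrow> None
    | Some y \<Rightarrow> if length y = n - b then Some y else None)"

lemma domain_oracle_test_SomeD:
  assumes "domain_oracle_test M E b n t = Some y"
  shows "output_within M {p. E t p \<and> length p \<le> n} n t = Some y" "length y = n - b"
  using assms by (auto simp: domain_oracle_test_def split: option.splits if_splits)

lemma computable_domain_oracle_test:
  assumes M: "oracle_turing_machine M" and E: "computable (\<lambda>z. E (fst z) (snd z))"
  shows "computable (\<lambda>z. domain_oracle_test M E b (fst z) (snd z))"
proof -
  have "computable (\<lambda>z. output_within M {p. E (snd z) p \<and> length p \<le> fst z} (fst z) (snd z))"
    by (rule computable_output_within[OF M, of "\<lambda>z p. E (snd z) p \<and> length p \<le> fst z"])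
      (intro computable_intros computable_compose2[OF E])+
  then show ?thesis
    unfolding domain_oracle_test_def by (intro computable_intros)
qed

text \<open>Outputs map injectively to the cardinality of an oracle that produced them; the
  additional 1 accounts for the empty oracle.\<close>

lemma card_domain_oracle_outputs:
  assumes inc: "\<And>p. mono (\<lambda>t. E t p)"
  shows "card {y. \<exists>t<s. domain_oracle_test M E b n t = Some y} \<le> Suc (card {p. (\<exists>t. E t p) \<and> length p \<le> n})"
proof -
  have mono: "E t p \<Longrightarrow> t \<le> t' \<Longrightarrow> E t' p" for t t' p
    using monoD[OF inc[of p], of t t'] by simp
  let ?Y = "{y. \<exists>t<s. domain_oracle_test M E b n t = Some y}"
  let ?P = "{p. (\<exists>t. E t p) \<and> length p \<le> n}"
  define A where "A t = {p. E t p \<and> length p \<le> n}" for t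
  have fin: "finite ?P"
    by (rule finite_subset[of _ "\<Union>m\<le>n. {x. length x = m}"]) auto
  have AP: "A t \<subseteq> ?P" for t by (auto simp: A_def)
  have "\<forall>y\<in>?Y. \<exists>t. output_within M (A t) n t = Some y"
    unfolding A_def using domain_oracle_test_SomeD(1) by blast
  then obtain T where T: "\<And>y. y \<in> ?Y \<Longrightarrow> output_within M (A (T y)) n (T y) = Some y" by metis
  have A_eq: "A t = A t'" if "card (A t) = card (A t')" "t \<le> t'" for t t'
    using that mono by (intro card_subset_eq finite_subset[OF AP fin]) (auto simp: A_def)
  have "inj_on (\<lambda>y. card (A (T y))) ?Y"
  proof (rule inj_onI)
    fix x y assume xy: "x \<in> ?Y" "y \<in> ?Y" "card (A (T x)) = card (A (T y))"
    then have "A (T x) = A (T y)" using A_eq by (metis linear)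
    then show "x = y" using T[OF xy(1)] T[OF xy(2)] by (auto dest: output_within_unique)
  qed
  moreover have "(\<lambda>y. card (A (T y))) ` ?Y \<subseteq> {..card ?P}"
    using card_mono[OF fin AP] by auto
  ultimately have "card ?Y \<le> card {..card ?P}" by (rule card_inj_on_le) simp
  then show ?thesis by simp
qed

lemma sum_half_powers_from: "(\<Sum>n<s. of_bool (l \<le> n) / 2 ^ n :: real) \<le> 2 / 2 ^ l"
proof -
  \<comment> \<open>The exact value carries the induction on \<open>s\<close>, which the bound alone
    would not.\<close>
  have "(\<Sum>n<s. of_bool (l \<le> n) / 2 ^ n :: real) = (if s \<le> l then 0 else 2 / 2 ^ l - 2 / 2 ^ s)"
    by (induction s) (auto simp: le_Suc_eq)
  then show ?thesis by simp
qed

text \<open>Length \<open>n - b\<close> in place of \<open>n\<close> costs the factor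
  \<open>2 ^ b\<close>. In the remaining \<open>2 + 2\<close>, one 2 bounds the sum of the
  \<open>1 / 2 ^ n\<close>, for the additional output at each \<open>n\<close>; the other is twice
  the Kraft bound.\<close>

lemma test_weight_domain_oracle_test:
  assumes inc: "\<And>p. mono (\<lambda>t. E t p)" and pf: "prefix_free {p. \<exists>t. E t p}"
  shows "test_weight (domain_oracle_test M E b) s \<le> 2 ^ (b + 2)"
proof -
  let ?C = "domain_oracle_test M E b" and ?N = "\<lambda>n. card {p. (\<exists>t. E t p) \<and> length p \<le> n}"
  let ?F = "{p. (\<exists>t. E t p) \<and> length p < s}"
  have finF: "finite ?F"
    by (rule finite_subset[of _ "\<Union>m<s. {x. length x = m}"]) auto
  have "test_weight ?C s \<le> (\<Sum>n<s. 2 ^ b * (1 / 2 ^ n + ?N n / 2 ^ n))"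
    unfolding test_weight_def
  proof (rule sum_mono)
    fix n
    let ?Y = "{y. \<exists>t<s. ?C n t = Some y}"
    \<comment> \<open>Only an inequality, because \<open>n - b\<close> is 0 for
      \<open>n < b\<close>.\<close>
    have "(2::real) ^ n \<le> 2 ^ (b + (n - b))" by (rule power_increasing) auto
    then have len: "1 / 2 ^ (n - b) \<le> (2::real) ^ b / 2 ^ n" by (simp add: power_add field_simps)
    have "(\<Sum>y\<in>?Y. 1 / 2 ^ length y) = (\<Sum>y\<in>?Y. 1 / 2 ^ (n - b) :: real)"
      by (rule sum.cong) (auto dest: domain_oracle_test_SomeD)
    also have "\<dots> = card ?Y * (1 / 2 ^ (n - b))" by simp
    also have "\<dots> \<le> Suc (?N n) * (2 ^ b / 2 ^ n)"
      by (intro mult_mono len) (simp_all only: of_nat_le_iff card_domain_oracle_outputs[OF inc], simp_all)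
    also have "\<dots> = 2 ^ b * (1 / 2 ^ n + ?N n / 2 ^ n)" by (simp add: field_simps)
    finally show "(\<Sum>y\<in>?Y. 1 / 2 ^ length y) \<le> 2 ^ b * (1 / 2 ^ n + ?N n / 2 ^ n)" .
  qed
  also have "\<dots> = 2 ^ b * ((\<Sum>n<s. 1 / 2 ^ n) + (\<Sum>n<s. ?N n / 2 ^ n))"
    by (simp only: sum_distrib_left[symmetric] sum.distrib)
  also have "\<dots> \<le> 2 ^ b * (2 + 2)"
  proof (intro mult_left_mono add_mono)
    show "(\<Sum>n<s. 1 / 2 ^ n :: real) \<le> 2" using sum_half_powers_from[of 0 s] by simp
    \<comment> \<open>The sum is rearranged by programs: one of length \<open>l\<close> is counted
      at every \<open>n \<ge> l\<close>, with total at most \<open>2 / 2 ^ l\<close>.\<close>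
    have "(\<Sum>n<s. ?N n / 2 ^ n) = (\<Sum>n<s. \<Sum>p\<in>?F. of_bool (length p \<le> n) / 2 ^ n :: real)"
    proof (rule sum.cong)
      fix n assume "n \<in> {..<s}"
      then have "{p. (\<exists>t. E t p) \<and> length p \<le> n} = ?F \<inter> {p. length p \<le> n}" by auto
      moreover have "(\<Sum>p\<in>?F. of_bool (length p \<le> n) :: real) = card (?F \<inter> {p. length p \<le> n})"
        by (intro sum_of_bool_eq finF)
      ultimately show "?N n / 2 ^ n = (\<Sum>p\<in>?F. of_bool (length p \<le> n) / 2 ^ n :: real)"
        by (simp only: sum_divide_distrib[symmetric])
    qed simp
    also have "\<dots> = (\<Sum>p\<in>?F. \<Sum>n<s. of_bool (length p \<le> n) / 2 ^ n)" by (rule sum.swap)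
    also have "\<dots> \<le> (\<Sum>p\<in>?F. 2 * (1 / 2 ^ length p))"
      by (intro sum_mono) (use sum_half_powers_from in simp)
    also have "\<dots> = 2 * (\<Sum>p\<in>?F. 1 / 2 ^ length p)" by (simp only: sum_distrib_left)
    also have "\<dots> \<le> 2 * 1"
      using pf by (intro mult_left_mono kraft_inequality finF) (auto simp: prefix_free_def)
    finally show "(\<Sum>n<s. ?N n / 2 ^ n) \<le> (2::real)" by simp
  qed simp
  also have "\<dots> = (2::real) ^ (b + 2)" by (simp add: power_add)
  finally show ?thesis .
qed

text \<open>The true oracle is finite, so some stage has enumerated all of it; monotonicity lets the
  same stage exceed the halting time.\<close>

lemma domain_oracle_test_complete:
  assumes inc: "\<And>p. mono (\<lambda>t. E t p)"
    and out: "machine_output M (restrict_strings {p. \<exists>t. E t p} (int n)) n = Some y"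
    and len: "length y = n - b"
  shows "\<exists>t. domain_oracle_test M E b n t = Some y"
proof -
  have mono: "E t p \<Longrightarrow> t \<le> t' \<Longrightarrow> E t' p" for t t' p
    using monoD[OF inc[of p], of t t'] by simp
  let ?A = "restrict_strings {p. \<exists>t. E t p} (int n)"
  have fin: "finite ?A"
    by (rule finite_subset[of _ "\<Union>m\<le>n. {x. length x = m}"]) (auto simp: restrict_strings_def)
  have "\<forall>p\<in>?A. \<exists>t. E t p" by (auto simp: restrict_strings_def)
  then obtain T where T: "\<And>p. p \<in> ?A \<Longrightarrow> E (T p) p" by metis
  obtain t0 where t0: "output_within M ?A n t0 = Some y" using machine_output_SomeD[OF out] by blast
  define t where "t = Max (insert t0 (T ` ?A))"
  have t: "t0 \<le> t" "\<And>p. p \<in> ?A \<Longrightarrow> T p \<le> t" using fin by (auto simp: t_def)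
  have "{p. E t p \<and> length p \<le> n} = ?A"
    using mono[OF T t(2)] by (auto simp: restrict_strings_def)
  then have "domain_oracle_test M E b n t = Some y"
    using output_within_mono[OF t0 t(1)] len by (simp add: domain_oracle_test_def)
  then show ?thesis by blast
qed

theorem theorem4p6:
  fixes U V :: "bool list \<rightharpoonup> bool list" and \<alpha> :: real
  assumes "optimal U"
    and "weakly_chaitin_random U \<alpha>"
    and "optimal V"
  shows "\<forall>f :: nat \<Rightarrow> nat. total_recursive_pos f \<longrightarrow>
    (\<exists>M. oracle_turing_machine M \<and>
      infinite {n. n \<ge> 1 \<and>
        machine_output M (restrict_strings (dom V) (int n)) n
          = Some (restrict_real \<alpha> (int n - int (f n)))}) \<longrightarrow>
    \<not> bdd_above (f ` {1..})"
proof (intro allI impI notI)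
  fix f :: "nat \<Rightarrow> nat"
  assume bdd: "bdd_above (f ` {1..})"
    and "\<exists>M. oracle_turing_machine M \<and> infinite {n. n \<ge> 1 \<and>
        machine_output M (restrict_strings (dom V) (int n)) n = Some (restrict_real \<alpha> (int n - int (f n)))}"
  then obtain M where M: "oracle_turing_machine M" and inf: "infinite {n. n \<ge> 1 \<and>
      machine_output M (restrict_strings (dom V) (int n)) n = Some (restrict_real \<alpha> (int n - int (f n)))}"
      (is "infinite ?S")
    by blast
  have "finite (f ` ?S)"
    by (rule finite_subset[OF image_mono bdd_above_nat[THEN iffD1, OF bdd]]) auto
  then obtain b where b: "infinite {n \<in> ?S. f n = b}"
    using pigeonhole_infinite[OF inf] by blast
  let ?\<beta> = "fractional_bits \<alpha>"
  obtain E where E: "computable (\<lambda>z. E (fst z) (snd z))" and "\<forall>t t' p. E t p \<longrightarrow> t \<le> t' \<longrightarrow> E t' p"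
    and "\<forall>p. p \<in> dom V \<longleftrightarrow> (\<exists>t::nat. E t p)"
    using partial_recursive_stages[of V] assms(3) by (auto simp: optimal_def computer_def)
  then have inc: "\<And>p. mono (\<lambda>t. E t p)" and domV: "dom V = {p. \<exists>t. E t p}"
    by (auto intro!: monoI)
  have pf: "prefix_free {p. \<exists>t. E t p}"
    using assms(3) by (simp add: optimal_def computer_def domV)
  let ?C = "domain_oracle_test M E b"
  have "{n \<in> ?S. f n = b} \<subseteq> {n. \<exists>t m. ?C n t = Some (map ?\<beta> [0..<m])}"
  proof
    fix n assume "n \<in> {n \<in> ?S. f n = b}"
    \<comment> \<open>For \<open>n < b\<close> the integer length is negative and gives the empty
      string, in agreement with truncated subtraction.\<close>
    then have "machine_output M (restrict_strings {p. \<exists>t. E t p} (int n)) n = Some (map ?\<beta> [0..<n - b])"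
      by (simp add: domV restrict_real_def nat_diff_distrib')
    then show "n \<in> {n. \<exists>t m. ?C n t = Some (map ?\<beta> [0..<m])}"
      using domain_oracle_test_complete[of E M n "map ?\<beta> [0..<n - b]" b, OF inc] by auto
  qed
  then have inf': "infinite {n. \<exists>t m. ?C n t = Some (map ?\<beta> [0..<m])}"
    using b finite_subset by blast
  obtain c where c: "\<And>n. n \<ge> 1 \<Longrightarrow> int n - int c \<le> int (H U (restrict_real \<alpha> (int n)))"
    using assms(2) unfolding weakly_chaitin_random_def by blast
  have "\<exists>s\<ge>1. H U (map ?\<beta> [0..<s]) + c < s"
  proof (rule solovay_test_compresses[OF assms(1) computable_domain_oracle_test[OF M E, of b] _ _ inf'])
    show "length y \<le> n" if "?C n t = Some y" for n t y
      using domain_oracle_test_SomeD(2)[OF that] by simp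
    show "test_weight ?C s \<le> 2 ^ (b + 2)" for s
      by (rule test_weight_domain_oracle_test[OF inc pf])
  qed
  then obtain s where "s \<ge> 1" "H U (map ?\<beta> [0..<s]) + c < s" by blast
  then show False using c[of s] by (simp add: restrict_real_def)
qed

end
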